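(* Let $\mathtt B$ be a bounded set in $C_b^{\ell,\beta-\ell}(\mathbb R^{\mathsf d})$, let $\hat{\mathcal X}$ be a measurable set in $\mathbb R^{\mathsf d}$, and let $\psi:\mathbb R^{\mathsf d}\to\mathbb R$ be bounded and measurable. Let $\xi_{n,j},\xi'_{n,j}$ ($1\le j\le n$, $n\in\mathbb N$) be $\mathbb R^{\mathsf d}$-valued random variables. Suppose that the $C_b^{\ell,\beta-\ell}(\mathbb R^{\mathsf d})$-valued random variables $V_n$ ($n\in\mathbb N$) satisfy (i) $V_n\in\mathtt B$ a.s. for $n\in\mathbb N$, and (ii) $V_n\ge0$ a.s. for $n\in\mathbb N$. Let $(d_n)_{n\in\mathbb N}$ be a sequence of positive numbers with $d_n\to0$ as $n\to\infty$, and let $\epsilon\in(0,1]$. Let $E_n$ and $P_n(a)$ be as defined in the context. Then: (a) For $f\in\mathtt B$ and $n\in\mathbb N$, $f*\varphi_{d_n}(x)=\int_{\mathbb R^{\mathsf d}}f(a)\varphi_{d_n}(x-a)\,da=f(x)+\bar\epsilon_n(f,x)$, where $\sup_{f\in\mathtt B,\,x\in\mathbb R^{\mathsf d}}|\bar\epsilon_n(f,x)|=O(d_n^\beta)$ as $d_n\to0$. (b) There exist constants $C(\hat{\mathcal X},\mathtt K)$ and $C(\mathtt B,\mathtt K)$ such that for all $n\in\mathbb N$ $$E_n\le C(\hat{\mathcal X},\mathtt K)\big(\sup_m\|V_m\|_\infty\big)\|\psi\|_\infty d_n^{-\mathsf d}\sup_{a\in\hat{\mathcal X}}P_n(a)+C(\mathtt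 B,\mathtt K)\|\psi\|_\infty d_n^\beta+(2+\epsilon)d_n^{-\mathsf d}\|\mathtt K\|_\infty^{\mathsf d}\|\psi\|_\infty E\Big[\int_{\hat{\mathcal X}^c}V_n(a)\,da\Big].$$ (c) If in addition $\varphi_{d_n}*V_n=V_n$ a.s., then instead of the inequality in (b) one has $$E_n\le C(\hat{\mathcal X},\mathtt K)\big(\sup_m\|V_m\|_\infty\big)\|\psi\|_\infty d_n^{-\mathsf d}\sup_{a\in\hat{\mathcal X}}P_n(a)+(2+\epsilon)d_n^{-\mathsf d}\|\mathtt K\|_\infty^{\mathsf d}\|\psi\|_\infty E\Big[\int_{\hat{\mathcal X}^c}V_n(a)\,da\Big].$$
   Context: Let $\beta>0$ and $\ell$ the largest integer with $\ell<\beta$. $C_b^{\ell,\beta-\ell}(\mathbb R^{\mathsf d})$ is the space of $\ell$-times continuously differentiable $f:\mathbb R^{\mathsf d}\to\mathbb R$ with finite norm $\sum_{i=0}^\ell\sup_x|\partial^if(x)|+\sup_{x\ne y}|\partial^\ell f(x)-\partial^\ell f(y)|/|x-y|^{\beta-\ell}$, equipped with the Borel $\sigma$-field of this norm. $\mathtt K:\mathbb R\to\mathbb R$ is a kernel function of order $\ell$ (possibly taking negative values), i.e. $\mathtt K$ is continuous and satisfies $\int|x|^s|\mathtt K(x)|dx<\infty$ for $s=0,1,\dots,\ell$, $\int\mathtt K(x)dx=1$, $\int x^s\mathtt K(x)dx=0$ for $s=1,\dots,\ell$. For $d_n>0$, $\varphi_{d_n}(x)=d_n^{-\mathsf d}\prod_{i=1}^{\mathsf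 d}\mathtt K(d_n^{-1}x_i)$ for $x=(x_i)\in\mathbb R^{\mathsf d}$. $\|\psi\|_\infty$ and $\|\mathtt K\|_\infty$ are sup norms; $\|V_m\|_\infty$ is the (essential) supremum of $|V_m(x)|$ over $\Omega$ and $x\in\mathbb R^{\mathsf d}$. $E_n=E\big[n^{-1}\sum_{j=1}^nV_n(\xi'_{n,j})\psi(\xi'_{n,j})\big]-(1+\epsilon)E\big[n^{-1}\sum_{j=1}^nV_n(\xi_{n,j})\psi(\xi_{n,j})\big]$. $P_n(a)=P\big[n^{-1}\sum_{j=1}^n\varphi_{d_n}(\xi'_{n,j}-a)\psi(\xi'_{n,j})-(1+\epsilon)n^{-1}\sum_{j=1}^n\varphi_{d_n}(\xi_{n,j}-a)\psi(\xi_{n,j})>0\big]$.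
   Formalization: The rate O(d_n^β) in (a) and finiteness of C(B,K) are claimed only if ∫|x|^β|K(x)|dx<∞, and finiteness of C(X̂,K) only if X̂ has finite Lebesgue measure and K is bounded; without these conditions the printed claims can fail. *)

theory Defs
  imports "HOL-Probability.Probability" "HOL-Library.Landau_Symbols"
begin

primrec cont_diff :: "nat \<Rightarrow> (real^'d \<Rightarrow> real) \<Rightarrow> bool" where
  "cont_diff 0 f \<longleftrightarrow> continuous_on UNIV f"
| "cont_diff (Suc k) f \<longleftrightarrow> (\<forall>x. f differentiable at x) \<and>
     (\<forall>i. cont_diff k (\<lambda>x. frechet_derivative f (at x) (axis i 1)))"

text \<open>The component of the derivative tensor of order \<open>length is\<close> of \<open>f\<close> at \<open>x\<close> in the
  coordinate directions listed in \<open>is\<close>.\<close>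

primrec partials :: "'d list \<Rightarrow> (real^'d \<Rightarrow> real) \<Rightarrow> real^'d \<Rightarrow> real" where
  "partials [] f = f"
| "partials (i # is) f = partials is (\<lambda>x. frechet_derivative f (at x) (axis i 1))"

text \<open>Derivative tensors are measured in the Euclidean norm.\<close>

definition holder_norm :: "nat \<Rightarrow> real \<Rightarrow> (real^'d \<Rightarrow> real) \<Rightarrow> ennreal" where
  "holder_norm l \<alpha> f =
     (\<Sum>i\<le>l. SUP x. ennreal (L2_set (\<lambda>is. partials is f x) {is. length is = i})) +
     (SUP (x, y) \<in> {(x, y). x \<noteq> y}.
        ennreal (L2_set (\<lambda>is. partials is f x - partials is f y) {is. length is = l}
                 / norm (x - y) powr \<alpha>))"

definition holder_space :: "nat \<Rightarrow> real \<Rightarrow> (real^'d \<Rightarrow> real) set" where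
  "holder_space l \<alpha> = {f. cont_diff l f \<and> holder_norm l \<alpha> f < \<infinity>}"

text \<open>The value outside the space is irrelevant; it is set to \<open>0\<close> because the locale
  \<^locale>\<open>Metric_space\<close> wants a distance that is symmetric on the whole type.\<close>

definition holder_dist :: "nat \<Rightarrow> real \<Rightarrow> (real^'d \<Rightarrow> real) \<Rightarrow> (real^'d \<Rightarrow> real) \<Rightarrow> real" where
  "holder_dist l \<alpha> f g =
     (if f \<in> holder_space l \<alpha> \<and> g \<in> holder_space l \<alpha>
      then enn2real (holder_norm l \<alpha> (\<lambda>x. f x - g x)) else 0)"

definition holder_borel :: "nat \<Rightarrow> real \<Rightarrow> (real^'d \<Rightarrow> real) measure" where
  "holder_borel l \<alpha> = sigma (holder_space l \<alpha>)
     {U. openin (Metric_space.mtopology (holder_space l \<alpha>) (holder_dist l \<alpha>)) U}"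

definition holder_bounded :: "nat \<Rightarrow> real \<Rightarrow> (real^'d \<Rightarrow> real) set \<Rightarrow> bool" where
  "holder_bounded l \<alpha> B \<longleftrightarrow>
     Metric_space.mbounded (holder_space l \<alpha>) (holder_dist l \<alpha>) B"

definition kernel_of_order :: "nat \<Rightarrow> (real \<Rightarrow> real) \<Rightarrow> bool" where
  "kernel_of_order l K \<longleftrightarrow> continuous_on UNIV K \<and>
     (\<forall>s\<le>l. integrable lborel (\<lambda>x. \<bar>x\<bar> ^ s * \<bar>K x\<bar>)) \<and>
     (\<integral>x. K x \<partial>lborel) = 1 \<and>
     (\<forall>s\<in>{1..l}. (\<integral>x. x ^ s * K x \<partial>lborel) = 0)"

definition mollifier :: "(real \<Rightarrow> real) \<Rightarrow> real \<Rightarrow> real^'d \<Rightarrow> real" where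
  "mollifier K d x = 1 / d ^ CARD('d) * (\<Prod>i\<in>UNIV. K (x $ i / d))"

definition convolve :: "(real^'d \<Rightarrow> real) \<Rightarrow> (real^'d \<Rightarrow> real) \<Rightarrow> real^'d \<Rightarrow> real" where
  "convolve f g x = (\<integral>a. f a * g (x - a) \<partial>lborel)"

definition sup_norm :: "('a \<Rightarrow> real) \<Rightarrow> ennreal" where
  "sup_norm f = (SUP x. ennreal \<bar>f x\<bar>)"

text \<open>Random arrays \<open>\<xi> n j\<close> and random functions \<open>V n\<close> are indexed by \<open>n \<ge> 1\<close> and
  \<open>1 \<le> j \<le> n\<close>; values at other indices are never used.\<close>

definition E_diff ::
  "'w measure \<Rightarrow> (nat \<Rightarrow> 'w \<Rightarrow> real^'d \<Rightarrow> real) \<Rightarrow> (real^'d \<Rightarrow> real) \<Rightarrow> (nat \<Rightarrow> nat \<Rightarrow> 'w \<Rightarrow> real^'d) \<Rightarrow>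
   (nat \<Rightarrow> nat \<Rightarrow> 'w \<Rightarrow> real^'d) \<Rightarrow> real \<Rightarrow> nat \<Rightarrow> real" where
  "E_diff M V \<psi> \<xi> \<xi>' \<epsilon> n =
     (\<integral>\<omega>. 1 / real n * (\<Sum>j=1..n. V n \<omega> (\<xi>' n j \<omega>) * \<psi> (\<xi>' n j \<omega>)) \<partial>M) -
     (1 + \<epsilon>) * (\<integral>\<omega>. 1 / real n * (\<Sum>j=1..n. V n \<omega> (\<xi> n j \<omega>) * \<psi> (\<xi> n j \<omega>)) \<partial>M)"

definition P_exceed ::
  "'w measure \<Rightarrow> (real \<Rightarrow> real) \<Rightarrow> (nat \<Rightarrow> real) \<Rightarrow> (real^'d \<Rightarrow> real) \<Rightarrow> (nat \<Rightarrow> nat \<Rightarrow> 'w \<Rightarrow> real^'d) \<Rightarrow>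
   (nat \<Rightarrow> nat \<Rightarrow> 'w \<Rightarrow> real^'d) \<Rightarrow> real \<Rightarrow> nat \<Rightarrow> real^'d \<Rightarrow> real" where
  "P_exceed M K d \<psi> \<xi> \<xi>' \<epsilon> n a = measure M {\<omega> \<in> space M.
     1 / real n * (\<Sum>j=1..n. mollifier K (d n) (\<xi>' n j \<omega> - a) * \<psi> (\<xi>' n j \<omega>)) -
     (1 + \<epsilon>) * (1 / real n) * (\<Sum>j=1..n. mollifier K (d n) (\<xi> n j \<omega> - a) * \<psi> (\<xi> n j \<omega>)) > 0}"

definition ess_sup_norm :: "'w measure \<Rightarrow> ('w \<Rightarrow> real^'d \<Rightarrow> real) \<Rightarrow> ennreal" where
  "ess_sup_norm M V = esssup M (\<lambda>\<omega>. sup_norm (V \<omega>))"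

locale smoothing_setting = prob_space M
  for M :: "'w measure" +
  fixes l :: nat and \<alpha> :: real
    and B :: "(real^'d \<Rightarrow> real) set" and X :: "(real^'d) set" and \<psi> :: "real^'d \<Rightarrow> real"
    and \<xi> \<xi>' :: "nat \<Rightarrow> nat \<Rightarrow> 'w \<Rightarrow> real^'d"
    and V :: "nat \<Rightarrow> 'w \<Rightarrow> real^'d \<Rightarrow> real"
    and d :: "nat \<Rightarrow> real" and \<epsilon> :: real
  assumes B_bounded: "holder_bounded l \<alpha> B"
    and X_measurable: "X \<in> sets borel"
    and psi_measurable: "\<psi> \<in> borel_measurable borel"
    and psi_bounded: "bounded (range \<psi>)"
    and xi_random: "\<And>n j. 1 \<le> j \<Longrightarrow> j \<le> n \<Longrightarrow> random_variable borel (\<xi> n j)"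
    and xi'_random: "\<And>n j. 1 \<le> j \<Longrightarrow> j \<le> n \<Longrightarrow> random_variable borel (\<xi>' n j)"
    and V_random: "\<And>n. n \<ge> 1 \<Longrightarrow> random_variable (holder_borel l \<alpha>) (V n)"
    and V_in_B: "\<And>n. n \<ge> 1 \<Longrightarrow> AE \<omega> in M. V n \<omega> \<in> B"
    and V_nonneg: "\<And>n. n \<ge> 1 \<Longrightarrow> AE \<omega> in M. \<forall>x. V n \<omega> x \<ge> 0"
    and d_pos: "\<And>n. n \<ge> 1 \<Longrightarrow> d n > 0"
    and d_lim: "d \<longlonglongrightarrow> 0"
    and eps: "0 < \<epsilon>" "\<epsilon> \<le> 1"

text \<open>The rest of this theory shows that \<^const>\<open>holder_dist\<close> is indeed a metric on
  \<^const>\<open>holder_space\<close>, so that the notions from \<^locale>\<open>Metric_space\<close> used above have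
  their intended meaning.\<close>

lemma finite_lists_length: "finite {is :: 'd::finite list. length is = i}"
  using finite_lists_length_eq[of "UNIV :: 'd set" i] by simp

lemma fderiv_diff:
  fixes f g :: "real^'d \<Rightarrow> real"
  assumes "f differentiable at x" "g differentiable at x"
  shows "frechet_derivative (\<lambda>x. f x - g x) (at x) v =
         frechet_derivative f (at x) v - frechet_derivative g (at x) v"
proof -
  have "((\<lambda>x. f x - g x) has_derivative
          (\<lambda>v. frechet_derivative f (at x) v - frechet_derivative g (at x) v)) (at x)"
    using assms by (intro has_derivative_diff) (simp_all add: frechet_derivative_works[symmetric])
  from frechet_derivative_at[OF this] show ?thesis by metis
qed

lemma cont_diff_diff:
  fixes f g :: "real^'d \<Rightarrow> real"
  shows "cont_diff k f \<Longrightarrow> cont_diff k g \<Longrightarrow> cont_diff k (\<lambda>x. f x - g x)"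
proof (induction k arbitrary: f g)
  case 0 then show ?case by (auto intro: continuous_on_diff)
next
  case (Suc k) then show ?case by (auto simp: fderiv_diff)
qed

lemma partials_diff:
  fixes f g :: "real^'d \<Rightarrow> real"
  shows "cont_diff k f \<Longrightarrow> cont_diff k g \<Longrightarrow> length is \<le> k \<Longrightarrow>
    partials is (\<lambda>x. f x - g x) = (\<lambda>x. partials is f x - partials is g x)"
proof (induction "is" arbitrary: f g k)
  case Nil then show ?case by simp
next
  case (Cons i "is")
  then obtain k' where k: "k = Suc k'" by (cases k) auto
  with Cons.prems have "partials is (\<lambda>x. frechet_derivative f (at x) (axis i 1) - frechet_derivative g (at x) (axis i 1)) =
      (\<lambda>x. partials is (\<lambda>x. frechet_derivative f (at x) (axis i 1)) x - partials is (\<lambda>x. frechet_derivative g (at x) (axis i 1)) x)"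
    by (intro Cons.IH[of k']) auto
  with Cons.prems k show ?case by (simp add: fderiv_diff)
qed

lemma L2_set_diff_commute: "L2_set (\<lambda>i. f i - g i) A = L2_set (\<lambda>i. g i - f i) A"
  by (simp add: L2_set_def power2_commute)

lemma L2_set_diff_triangle: "L2_set (\<lambda>i. f i - h i) A \<le> L2_set (\<lambda>i. f i - g i) A + L2_set (\<lambda>i. g i - h i) A"
  using L2_set_triangle_ineq[of "\<lambda>i. f i - g i" "\<lambda>i. g i - h i" A] by simp

lemma L2_set_length_cong:
  "i \<le> l \<Longrightarrow> (\<And>is. length is \<le> l \<Longrightarrow> F is = G is) \<Longrightarrow>
    L2_set F {is. length is = i} = L2_set G {is. length is = i}"
  by (rule L2_set_cong) auto

lemma holder_norm_diff:
  fixes f g :: "real^'d \<Rightarrow> real"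
  assumes "cont_diff l f" "cont_diff l g"
  shows "holder_norm l \<alpha> (\<lambda>x. f x - g x) =
     (\<Sum>i\<le>l. SUP x. ennreal (L2_set (\<lambda>is. partials is f x - partials is g x) {is. length is = i})) +
     (SUP (x, y) \<in> {(x, y). x \<noteq> y}.
        ennreal (L2_set (\<lambda>is. (partials is f x - partials is f y) - (partials is g x - partials is g y)) {is. length is = l}
                 / norm (x - y) powr \<alpha>))"
proof -
  have *: "partials is (\<lambda>x. f x - g x) x = partials is f x - partials is g x"
    if "length is \<le> l" for "is" x
    using partials_diff[OF assms that] by simp
  have "(\<Sum>i\<le>l. SUP x. ennreal (L2_set (\<lambda>is. partials is (\<lambda>x. f x - g x) x) {is. length is = i})) =
     (\<Sum>i\<le>l. SUP x. ennreal (L2_set (\<lambda>is. partials is f x - partials is g x) {is. length is = i}))"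
    by (intro sum.cong refl SUP_cong arg_cong[where f=ennreal] L2_set_length_cong[of _ l]) (auto simp: *)
  moreover have "L2_set (\<lambda>is. partials is (\<lambda>x. f x - g x) x - partials is (\<lambda>x. f x - g x) y) {is. length is = l} =
      L2_set (\<lambda>is. (partials is f x - partials is f y) - (partials is g x - partials is g y)) {is. length is = l}" for x y
    by (rule L2_set_length_cong[of l l]) (auto simp: *)
  ultimately show ?thesis
    unfolding holder_norm_def by simp
qed

lemma holder_norm_diff_commute:
  fixes f g :: "real^'d \<Rightarrow> real"
  assumes "cont_diff l f" "cont_diff l g"
  shows "holder_norm l \<alpha> (\<lambda>x. f x - g x) = holder_norm l \<alpha> (\<lambda>x. g x - f x)"
  unfolding holder_norm_diff[OF assms] holder_norm_diff[OF assms(2,1)]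
  by (subst (1 2) L2_set_diff_commute) (rule refl)

lemma holder_norm_diff_triangle:
  fixes f g h :: "real^'d \<Rightarrow> real"
  assumes "cont_diff l f" "cont_diff l g" "cont_diff l h"
  shows "holder_norm l \<alpha> (\<lambda>x. f x - h x) \<le>
    holder_norm l \<alpha> (\<lambda>x. f x - g x) + holder_norm l \<alpha> (\<lambda>x. g x - h x)"
proof -
  have a: "(SUP x\<in>A. ennreal (F x)) \<le> (SUP x\<in>A. ennreal (G x)) + (SUP x\<in>A. ennreal (H x))"
    if "\<And>x. x \<in> A \<Longrightarrow> F x \<le> G x + H x" "\<And>x. x \<in> A \<Longrightarrow> 0 \<le> G x" "\<And>x. x \<in> A \<Longrightarrow> 0 \<le> H x"
    for A and F G H :: "'z \<Rightarrow> real"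
  proof (rule SUP_least)
    fix x assume x: "x \<in> A"
    have "ennreal (F x) \<le> ennreal (G x) + ennreal (H x)"
      using that x by (simp add: ennreal_plus[symmetric] ennreal_leI del: ennreal_plus)
    also have "\<dots> \<le> (SUP x\<in>A. ennreal (G x)) + (SUP x\<in>A. ennreal (H x))"
      by (intro add_mono SUP_upper x)
    finally show "ennreal (F x) \<le> (SUP x\<in>A. ennreal (G x)) + (SUP x\<in>A. ennreal (H x))" .
  qed
  let ?S = "\<lambda>f h i. SUP x. ennreal (L2_set (\<lambda>is. partials is f x - partials is h x) {is. length is = i})"
  let ?H = "\<lambda>f h. \<lambda>(x, y). L2_set (\<lambda>is. (partials is f x - partials is f y) - (partials is h x - partials is h y)) {is. length is = l}
                 / norm (x - y) powr \<alpha>"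
  let ?T = "\<lambda>f h. SUP p \<in> {(x, y). x \<noteq> y}. ennreal (?H f h p)"
  have eq: "holder_norm l \<alpha> (\<lambda>x. f x - h x) = (\<Sum>i\<le>l. ?S f h i) + ?T f h"
    if "cont_diff l f" "cont_diff l h" for f h :: "real^'d \<Rightarrow> real"
    unfolding holder_norm_diff[OF that] by (simp add: case_prod_unfold)
  have "?S f h i \<le> ?S f g i + ?S g h i" for i
    by (rule a) (auto intro: L2_set_diff_triangle)
  then have "(\<Sum>i\<le>l. ?S f h i) \<le> (\<Sum>i\<le>l. ?S f g i) + (\<Sum>i\<le>l. ?S g h i)"
    by (simp add: sum.distrib[symmetric] sum_mono)
  moreover have "?T f h \<le> ?T f g + ?T g h"
  proof (rule a)
    fix p :: "(real^'d) \<times> (real^'d)"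
    obtain x y where p: "p = (x, y)" by (cases p)
    show "?H f h p \<le> ?H f g p + ?H g h p"
      unfolding p prod.case add_divide_distrib[symmetric]
      by (intro divide_right_mono L2_set_diff_triangle) auto
    show "0 \<le> ?H f g p" "0 \<le> ?H g h p"
      unfolding p by auto
  qed
  ultimately show ?thesis
    unfolding eq[OF assms(1,3)] eq[OF assms(1,2)] eq[OF assms(2,3)]
    using add_mono by (fastforce simp: ac_simps)
qed

lemma abs_le_holder_norm: "ennreal \<bar>f x\<bar> \<le> holder_norm l \<alpha> f"
proof -
  let ?S = "\<lambda>i. SUP x. ennreal (L2_set (\<lambda>is. partials is f x) {is. length is = i})"
  have "ennreal \<bar>f x\<bar> \<le> ?S 0"
    by (rule SUP_upper2[of x]) auto
  also have "\<dots> \<le> (\<Sum>i\<le>l. ?S i)"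
    by (rule member_le_sum) auto
  finally show ?thesis
    unfolding holder_norm_def by (metis (no_types, lifting) add_increasing2 zero_le)
qed

lemma zero_in_holder_space: "(\<lambda>x. 0) \<in> (holder_space l \<alpha> :: (real^'d \<Rightarrow> real) set)"
proof -
  have p: "partials is (\<lambda>x. 0) = (\<lambda>x. 0)" for "is" :: "'d list"
    by (induction "is") auto
  have "cont_diff l (\<lambda>x::real^'d. 0)"
    by (induction l) auto
  moreover have "holder_norm l \<alpha> (\<lambda>x::real^'d. 0) = 0"
    unfolding holder_norm_def p by (auto simp: L2_set_def image_def case_prod_unfold intro!: Sup_eqI)
  ultimately show ?thesis
    by (simp add: holder_space_def)
qed

lemma holder_norm_diff_finite:
  fixes f g :: "real^'d \<Rightarrow> real"
  assumes f: "f \<in> holder_space l \<alpha>" and g: "g \<in> holder_space l \<alpha>"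
  shows "holder_norm l \<alpha> (\<lambda>x. f x - g x) < \<infinity>"
proof -
  note z = zero_in_holder_space[of l \<alpha>, where 'd = 'd]
  have c: "cont_diff l f" "cont_diff l g" "cont_diff l (\<lambda>x::real^'d. 0)"
    using f g z by (simp_all add: holder_space_def)
  have "holder_norm l \<alpha> (\<lambda>x. f x - g x) \<le>
      holder_norm l \<alpha> (\<lambda>x. f x - 0) + holder_norm l \<alpha> (\<lambda>x. 0 - g x)"
    using holder_norm_diff_triangle[OF c(1,3,2)] .
  also have "\<dots> = holder_norm l \<alpha> f + holder_norm l \<alpha> g"
    using holder_norm_diff_commute[OF c(3,2)] by simp
  also have "\<dots> < \<infinity>"
    using f g by (simp add: holder_space_def)
  finally show ?thesis .
qed

lemma Metric_space_holder:
  "Metric_space (holder_space l \<alpha> :: (real^'d \<Rightarrow> real) set) (holder_dist l \<alpha>)"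
proof
  fix f g h :: "real^'d \<Rightarrow> real"
  show "0 \<le> holder_dist l \<alpha> f g"
    by (simp add: holder_dist_def)
  show "holder_dist l \<alpha> f g = holder_dist l \<alpha> g f"
    using holder_norm_diff_commute[of l f g \<alpha>] by (auto simp: holder_dist_def holder_space_def)
  assume f: "f \<in> holder_space l \<alpha>" and g: "g \<in> holder_space l \<alpha>"
  show "holder_dist l \<alpha> f g = 0 \<longleftrightarrow> f = g"
  proof
    assume "holder_dist l \<alpha> f g = 0"
    then have "holder_norm l \<alpha> (\<lambda>x. f x - g x) = 0"
      using holder_norm_diff_finite[OF f g] f g by (auto simp: holder_dist_def enn2real_eq_0_iff)
    then have "ennreal \<bar>f x - g x\<bar> = 0" for x
      using abs_le_holder_norm[of "\<lambda>x. f x - g x" x l \<alpha>] by simp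
    then show "f = g"
      by auto
  next
    assume "f = g"
    moreover have "holder_norm l \<alpha> (\<lambda>x. g x - g x) = 0"
      unfolding holder_norm_diff[OF g[unfolded holder_space_def, simplified, THEN conjunct1]
          g[unfolded holder_space_def, simplified, THEN conjunct1]]
      by (auto simp: L2_set_def case_prod_unfold image_def intro!: Sup_eqI)
    ultimately show "holder_dist l \<alpha> f g = 0"
      by (simp add: holder_dist_def)
  qed
  assume h: "h \<in> holder_space l \<alpha>"
  note fin = holder_norm_diff_finite[OF f g] holder_norm_diff_finite[OF g h]
  have "holder_norm l \<alpha> (\<lambda>x. f x - h x) \<le>
      holder_norm l \<alpha> (\<lambda>x. f x - g x) + holder_norm l \<alpha> (\<lambda>x. g x - h x)"
    using f g h by (intro holder_norm_diff_triangle) (auto simp: holder_space_def)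
  then have "enn2real (holder_norm l \<alpha> (\<lambda>x. f x - h x)) \<le>
      enn2real (holder_norm l \<alpha> (\<lambda>x. f x - g x) + holder_norm l \<alpha> (\<lambda>x. g x - h x))"
    using fin by (intro enn2real_mono) auto
  also have "\<dots> = enn2real (holder_norm l \<alpha> (\<lambda>x. f x - g x)) + enn2real (holder_norm l \<alpha> (\<lambda>x. g x - h x))"
    using fin by (intro enn2real_plus) auto
  finally show "holder_dist l \<alpha> f h \<le> holder_dist l \<alpha> f g + holder_dist l \<alpha> g h"
    using f g h by (simp add: holder_dist_def)
qed

end

theory Submission
  imports Defs
begin

text \<open>
  Smoothing by the product kernel is smoothing in one coordinate after the other. Along a single
  coordinate line the Taylor polynomial of degree \<open>l\<close> is reproduced exactly, because the moments of
  \<open>K\<close> of order \<open>1, \<dots>, l\<close> vanish, and the Hoelder condition on the last derivative bounds the remainder by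
  \<open>\<bar>h\<bar> powr \<beta>\<close>; so only pure partial derivatives enter, and the smoothing error is \<open>O(d powr \<beta>)\<close>.

  For the comparison of expectations, replace \<open>V\<close> by its smoothed version. Both averages are linear in
  the integrand, so their weighted difference becomes \<open>\<integral> V a * \<delta> a da\<close>, where \<open>\<delta> a\<close> is the random
  variable whose positivity has probability \<open>P_n(a)\<close>. Since \<open>\<delta>\<close> is uniformly bounded and \<open>V \<ge> 0\<close>, one uses
  \<open>V \<le> \<parallel>V\<parallel>\<close> and Fubini on \<open>X\<close>, and the bound on \<open>\<delta>\<close> outside \<open>X\<close>.
\<close>

section \<open>Hoelder spaces: pointwise consequences of a bound on the norm\<close>

lemma holder_spaceD:
  fixes f :: "real^'d \<Rightarrow> real"
  assumes "f \<in> holder_space l \<alpha>"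
  shows "cont_diff l f" "continuous_on UNIV f" "f \<in> borel_measurable borel"
proof -
  show c: "cont_diff l f" using assms by (simp add: holder_space_def)
  show "continuous_on UNIV f"
  proof (cases l)
    case (Suc k)
    with c show ?thesis
      by (auto intro!: continuous_at_imp_continuous_on differentiable_imp_continuous_within)
  qed (use c in simp)
  then show "f \<in> borel_measurable borel"
    by (rule borel_measurable_continuous_onI)
qed

text \<open>A metrically bounded set lies in some closed ball, whose centre can be any function. The
  triangle inequality through that centre, towards the zero function, gives the uniform norm bound
  that the later estimates use.\<close>

lemma holder_bounded_obtains:
  fixes B :: "(real^'d \<Rightarrow> real) set"
  assumes "holder_bounded l \<alpha> B"
  obtains R where "0 \<le> R" "B \<subseteq> holder_space l \<alpha>"
    "\<And>f. f \<in> B \<Longrightarrow> holder_norm l \<alpha> f \<le> ennreal R"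
proof -
  interpret Metric_space "holder_space l \<alpha> :: (real^'d \<Rightarrow> real) set" "holder_dist l \<alpha>"
    by (rule Metric_space_holder)
  let ?z = "\<lambda>_. 0 :: real"
  from assms obtain c r where cr: "B \<subseteq> mcball c r"
    by (auto simp: holder_bounded_def mbounded_def)
  \<comment> \<open>The maximum with \<open>0\<close> matters only for empty \<open>B\<close>, where
    the radius \<open>r\<close> may be negative.\<close>
  let ?R = "max 0 (r + holder_dist l \<alpha> c ?z)"
  have z: "?z \<in> (holder_space l \<alpha> :: (real^'d \<Rightarrow> real) set)"
    by (rule zero_in_holder_space)
  have "holder_norm l \<alpha> f \<le> ennreal ?R" if "f \<in> B" for f
  proof -
    from that cr have f: "f \<in> holder_space l \<alpha>" "c \<in> holder_space l \<alpha>" "holder_dist l \<alpha> c f \<le> r"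
      by auto
    have "enn2real (holder_norm l \<alpha> f) = holder_dist l \<alpha> f ?z"
      using f z by (simp add: holder_dist_def)
    also have "\<dots> \<le> holder_dist l \<alpha> f c + holder_dist l \<alpha> c ?z"
      using f z by (intro triangle)
    also have "\<dots> \<le> ?R"
      using f commute[of f c] by simp
    finally have "ennreal (enn2real (holder_norm l \<alpha> f)) \<le> ennreal ?R"
      by (rule ennreal_leI)
    with f show ?thesis by (simp add: holder_space_def)
  qed
  with cr that[of ?R] show ?thesis by force
qed

lemma abs_le_of_holder_norm_le:
  assumes "holder_norm l \<alpha> f \<le> ennreal R" "0 \<le> R"
  shows "\<bar>f x\<bar> \<le> R"
  using order_trans[OF abs_le_holder_norm assms(1), of x] assms(2) by simp

text \<open>The supremum of the Hoelder quotients is one nonnegative summand of the norm, and a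
  single component of the derivative tensor is at most the Euclidean norm of the whole
  tensor.\<close>

lemma holder_quotient_le_holder_norm:
  fixes f :: "real^'d \<Rightarrow> real"
  assumes n: "holder_norm l \<alpha> f \<le> ennreal R" and R: "0 \<le> R" and l: "length is = l"
  shows "\<bar>partials is f x - partials is f y\<bar> \<le> R * norm (x - y) powr \<alpha>"
proof (cases "x = y")
  case False
  let ?L = "\<lambda>x y. L2_set (\<lambda>is. partials is f x - partials is f y) {is. length is = l}"
  have "ennreal (?L x y / norm (x - y) powr \<alpha>) \<le>
      (SUP (x, y) \<in> {(x, y). x \<noteq> y}. ennreal (?L x y / norm (x - y) powr \<alpha>))"
    using False by (intro SUP_upper2[of "(x, y)"]) auto
  also have "\<dots> \<le> holder_norm l \<alpha> f"
    unfolding holder_norm_def by (rule add_increasing) auto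
  finally have "?L x y / norm (x - y) powr \<alpha> \<le> R"
    using n R by (meson ennreal_le_iff order_trans)
  then have "?L x y \<le> R * norm (x - y) powr \<alpha>"
    using False by (simp add: divide_simps)
  moreover have "\<bar>partials is f x - partials is f y\<bar> \<le> L2_set (\<lambda>is. \<bar>partials is f x - partials is f y\<bar>) {is. length is = l}"
    using l by (intro member_le_L2_set finite_lists_length) auto
  then have "\<bar>partials is f x - partials is f y\<bar> \<le> ?L x y"
    by (simp add: L2_set_def)
  ultimately show ?thesis by simp
qed (use R in simp)

section \<open>Taylor expansion along a coordinate line\<close>

text \<open>The case \<open>k = 0\<close> is the chain rule. Since \<open>partials\<close>
  differentiates in its first index first, the induction step applies the hypothesis to the partial
  derivative of \<open>f\<close>, with \<open>k\<close> and \<open>l\<close> both lowered by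
  one.\<close>

lemma has_real_derivative_partials_line:
  fixes f :: "real^'d \<Rightarrow> real"
  assumes "cont_diff l f" "k < l"
  shows "((\<lambda>t. partials (replicate k i) f (x + t *\<^sub>R axis i 1)) has_real_derivative
           partials (replicate (Suc k) i) f (x + t *\<^sub>R axis i 1)) (at t)"
  using assms
proof (induction k arbitrary: f l)
  case 0
  then obtain l' where "l = Suc l'" by (cases l) auto
  with 0 have f: "(f has_derivative frechet_derivative f (at (x + t *\<^sub>R axis i 1))) (at (x + t *\<^sub>R axis i 1))"
    by (simp add: frechet_derivative_works[symmetric])
  have "((\<lambda>t. x + t *\<^sub>R axis i 1) has_derivative (\<lambda>s. s *\<^sub>R axis i 1)) (at t)"
    by (auto intro!: derivative_eq_intros)
  from diff_chain_at[OF this f] have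
    "((\<lambda>t. f (x + t *\<^sub>R axis i 1)) has_derivative
       (\<lambda>s. frechet_derivative f (at (x + t *\<^sub>R axis i 1)) (s *\<^sub>R axis i 1))) (at t)"
    by (simp add: o_def)
  moreover have "frechet_derivative f (at y) (s *\<^sub>R axis i 1) =
      frechet_derivative f (at y) (axis i 1) * s" if "y = x + t *\<^sub>R axis i 1" for s y
    using linear_cmul[OF has_derivative_linear[OF f]] that by simp
  ultimately show ?case
    by (simp add: has_field_derivative_def)
next
  case (Suc k)
  then obtain l' where l': "l = Suc l'" by (cases l) auto
  with Suc.prems show ?case
    using Suc.IH[of l' "\<lambda>x. frechet_derivative f (at x) (axis i 1)"] by simp
qed

text \<open>The Lagrange remainder of order \<open>l\<close> contains the \<open>l\<close>-th
  derivative at an intermediate point. Replacing it by the derivative at \<open>x\<close> completes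
  the Taylor polynomial; what remains is a Hoelder increment of that derivative times
  \<open>h ^ l\<close>, up to the factor \<open>1 / fact l\<close>, which is at most 1.\<close>

lemma taylor_holder_line:
  fixes f :: "real^'d \<Rightarrow> real"
  assumes f: "cont_diff l f" and n: "holder_norm l \<alpha> f \<le> ennreal R" and R: "0 \<le> R" and \<alpha>: "0 \<le> \<alpha>"
  shows "\<bar>f (x + h *\<^sub>R axis i 1) - (\<Sum>m\<le>l. partials (replicate m i) f x / fact m * h ^ m)\<bar>
    \<le> R * \<bar>h\<bar> powr (real l + \<alpha>)"
proof -
  let ?D = "\<lambda>m t. partials (replicate m i) f (x + t *\<^sub>R axis i 1)"
  have "\<exists>t. \<bar>t\<bar> \<le> \<bar>h\<bar> \<and> f (x + h *\<^sub>R axis i 1) = (\<Sum>m<l. ?D m 0 / fact m * h ^ m) + ?D l t / fact l * h ^ l"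
    using has_real_derivative_partials_line[OF f]
    by (intro Maclaurin_bi_le[of ?D "\<lambda>h. f (x + h *\<^sub>R axis i 1)" l h]) auto
  then obtain t where t: "\<bar>t\<bar> \<le> \<bar>h\<bar>"
    "f (x + h *\<^sub>R axis i 1) = (\<Sum>m<l. ?D m 0 / fact m * h ^ m) + ?D l t / fact l * h ^ l"
    by blast
  have "{..l} = insert l {..<l}" by auto
  then have "f (x + h *\<^sub>R axis i 1) - (\<Sum>m\<le>l. partials (replicate m i) f x / fact m * h ^ m) =
      (?D l t - ?D l 0) / fact l * h ^ l"
    unfolding t(2) by (simp add: algebra_simps diff_divide_distrib)
  also have "\<bar>\<dots>\<bar> = \<bar>?D l t - ?D l 0\<bar> / fact l * \<bar>h\<bar> ^ l"
    by (simp add: abs_mult power_abs)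
  also have "\<dots> \<le> \<bar>?D l t - ?D l 0\<bar> / 1 * \<bar>h\<bar> ^ l"
    by (intro mult_right_mono divide_left_mono) (auto simp: fact_ge_1)
  also have "\<dots> \<le> (R * \<bar>t\<bar> powr \<alpha>) * \<bar>h\<bar> ^ l"
    using holder_quotient_le_holder_norm[OF n R, of "replicate l i" "x + t *\<^sub>R axis i 1" "x + 0 *\<^sub>R axis i 1"]
    by (intro mult_right_mono) simp_all
  also have "\<dots> \<le> (R * \<bar>h\<bar> powr \<alpha>) * \<bar>h\<bar> ^ l"
    using t(1) R \<alpha> by (intro mult_right_mono mult_left_mono powr_mono2) auto
  also have "\<dots> = R * \<bar>h\<bar> powr (real l + \<alpha>)"
    by (cases "h = 0") (simp_all add: powr_add powr_realpow)
  finally show ?thesis .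
qed

section \<open>Smoothing by the kernel in one variable\<close>

text \<open>As \<open>x ^ 0 = 1\<close>, normalisation and vanishing moments merge into one formula.
  The last bound makes the powers of the integral of \<open>\<bar>K\<bar>\<close> increase with the
  exponent.\<close>

lemma kernel_of_orderD:
  assumes "kernel_of_order l K"
  shows "K \<in> borel_measurable borel" "integrable lborel K" "(\<integral>x. K x \<partial>lborel) = 1"
    "\<And>s. s \<le> l \<Longrightarrow> integrable lborel (\<lambda>x. x ^ s * K x)"
    "\<And>s. s \<le> l \<Longrightarrow> (\<integral>x. x ^ s * K x \<partial>lborel) = (if s = 0 then 1 else 0)"
    "1 \<le> (\<integral>x. \<bar>K x\<bar> \<partial>lborel)"
proof -
  show m [measurable]: "K \<in> borel_measurable borel"
    using assms by (auto simp: kernel_of_order_def intro: borel_measurable_continuous_onI)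
  show s: "integrable lborel (\<lambda>x. x ^ s * K x)" if "s \<le> l" for s
  proof (rule Bochner_Integration.integrable_bound)
    show "integrable lborel (\<lambda>x. \<bar>x\<bar> ^ s * \<bar>K x\<bar>)"
      using assms that by (simp add: kernel_of_order_def)
  qed (simp_all add: abs_mult power_abs)
  show i: "integrable lborel K" using s[of 0] by simp
  show e: "(\<integral>x. K x \<partial>lborel) = 1" using assms by (simp add: kernel_of_order_def)
  show "(\<integral>x. x ^ s * K x \<partial>lborel) = (if s = 0 then 1 else 0)" if "s \<le> l" for s
    using assms that e by (cases "s = 0") (simp_all add: kernel_of_order_def)
  have "(\<integral>x. K x \<partial>lborel) \<le> (\<integral>x. \<bar>K x\<bar> \<partial>lborel)"
    using i by (intro integral_mono) auto
  with e show "1 \<le> (\<integral>x. \<bar>K x\<bar> \<partial>lborel)" by simp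
qed

lemma integrable_bounded_mult:
  fixes f g :: "'a \<Rightarrow> real"
  assumes "f \<in> borel_measurable M" "\<And>x. x \<in> space M \<Longrightarrow> \<bar>f x\<bar> \<le> C" "integrable M g"
  shows "integrable M (\<lambda>x. f x * g x)"
proof (rule Bochner_Integration.integrable_bound[of M "\<lambda>x. C * g x"])
  show "AE x in M. norm (f x * g x) \<le> norm (C * g x)"
  proof (rule AE_I2)
    fix x assume "x \<in> space M"
    then have "\<bar>f x\<bar> \<le> \<bar>C\<bar>" using assms(2)[of x] by simp
    then show "norm (f x * g x) \<le> norm (C * g x)"
      by (simp add: abs_mult mult_right_mono)
  qed
qed (use assms in auto)

text \<open>The Taylor polynomial at increment \<open>- d * s\<close> integrates against
  \<open>K\<close> to its constant term \<open>f x\<close>, because the higher moments vanish. The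
  error is thus the integral of the Taylor remainder, out of which
  \<open>d powr (real l + \<alpha>)\<close> factors.\<close>

lemma smoothing_error_line:
  fixes f :: "real^'d \<Rightarrow> real"
  assumes f: "f \<in> holder_space l \<alpha>" and n: "holder_norm l \<alpha> f \<le> ennreal R" and R: "0 \<le> R" and \<alpha>: "0 \<le> \<alpha>"
    and K: "kernel_of_order l K" and KI: "integrable lborel (\<lambda>s. \<bar>s\<bar> powr (real l + \<alpha>) * \<bar>K s\<bar>)" and d: "0 < d"
  shows "\<bar>(\<integral>s. f (x - (d * s) *\<^sub>R axis i 1) * K s \<partial>lborel) - f x\<bar>
    \<le> R * d powr (real l + \<alpha>) * (\<integral>s. \<bar>s\<bar> powr (real l + \<alpha>) * \<bar>K s\<bar> \<partial>lborel)"
proof -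
  note [measurable] = holder_spaceD(3)[OF f] kernel_of_orderD(1)[OF K]
  \<comment> \<open>\<open>?c m\<close> is the coefficient of \<open>s ^ m\<close> in the Taylor
    polynomial; the sign of \<open>- d\<close> comes from the reflected argument
    \<open>x - d * s\<close> along the line.\<close>
  let ?c = "\<lambda>m. partials (replicate m i) f x / fact m * (- d) ^ m"
  have i1: "integrable lborel (\<lambda>s. f (x - (d * s) *\<^sub>R axis i 1) * K s)"
  proof (rule integrable_bounded_mult)
    show "\<bar>f (x - (d * s) *\<^sub>R axis i 1)\<bar> \<le> R" for s
      by (rule abs_le_of_holder_norm_le[OF n R])
  qed (use kernel_of_orderD(2)[OF K] in simp_all)
  have i2: "integrable lborel (\<lambda>s. \<Sum>m\<le>l. ?c m * (s ^ m * K s))"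
    using kernel_of_orderD(4)[OF K] by (intro Bochner_Integration.integrable_sum integrable_mult_right) auto
  have "(\<integral>s. (\<Sum>m\<le>l. ?c m * (s ^ m * K s)) \<partial>lborel) = (\<Sum>m\<le>l. ?c m * (if m = 0 then 1 else 0))"
    using kernel_of_orderD(4,5)[OF K] by (subst Bochner_Integration.integral_sum) auto
  also have "\<dots> = f x" by (subst sum.mono_neutral_right[of _ "{0}"]) auto
  finally have eq: "(\<integral>s. f (x - (d * s) *\<^sub>R axis i 1) * K s \<partial>lborel) - f x =
      (\<integral>s. f (x - (d * s) *\<^sub>R axis i 1) * K s - (\<Sum>m\<le>l. ?c m * (s ^ m * K s)) \<partial>lborel)"
    using Bochner_Integration.integral_diff[OF i1 i2] by simp
  have "\<bar>\<integral>s. f (x - (d * s) *\<^sub>R axis i 1) * K s - (\<Sum>m\<le>l. ?c m * (s ^ m * K s)) \<partial>lborel\<bar> \<le> (\<integral>s. R * d powr (real l + \<alpha>) * (\<bar>s\<bar> powr (real l + \<alpha>) * \<bar>K s\<bar>) \<partial>lborel)"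
  proof (rule integral_abs_bound_integral)
    fix s :: real
    have "(\<Sum>m\<le>l. ?c m * (s ^ m * K s)) =
        (\<Sum>m\<le>l. partials (replicate m i) f x / fact m * (- d * s) ^ m) * K s"
      unfolding sum_distrib_right power_mult_distrib by (simp only: mult.assoc)
    then have "f (x - (d * s) *\<^sub>R axis i 1) * K s - (\<Sum>m\<le>l. ?c m * (s ^ m * K s)) =
        (f (x + (- d * s) *\<^sub>R axis i 1) - (\<Sum>m\<le>l. partials (replicate m i) f x / fact m * (- d * s) ^ m)) * K s"
      by (simp only: left_diff_distrib) simp
    also have "\<bar>\<dots>\<bar> \<le> (R * \<bar>- d * s\<bar> powr (real l + \<alpha>)) * \<bar>K s\<bar>"
      unfolding abs_mult[of "_ - _"]
      by (intro mult_right_mono taylor_holder_line[OF holder_spaceD(1)[OF f] n R \<alpha>]) auto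
    finally show "\<bar>f (x - (d * s) *\<^sub>R axis i 1) * K s - (\<Sum>m\<le>l. ?c m * (s ^ m * K s))\<bar> \<le>
        R * d powr (real l + \<alpha>) * (\<bar>s\<bar> powr (real l + \<alpha>) * \<bar>K s\<bar>)"
      using d by (simp only: abs_mult powr_mult abs_minus_cancel abs_of_pos mult.assoc abs_ge_zero)
  qed (use Bochner_Integration.integrable_diff[OF i1 i2] KI in simp_all)
  then show ?thesis
    unfolding eq by (simp only: integral_mult_right_zero)
qed

section \<open>Lebesgue measure on vectors, mollifiers and convolution\<close>

lemma borel_measurable_vec_component[measurable (raw)]:
  fixes f :: "'a \<Rightarrow> real^'d"
  shows "f \<in> borel_measurable M \<Longrightarrow> (\<lambda>x. f x $ i) \<in> borel_measurable M"
  by (rule measurable_compose[OF _ borel_measurable_nth])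

lemma borel_measurable_vec_lambda:
  fixes f :: "'d::finite \<Rightarrow> 'a \<Rightarrow> real"
  assumes "\<And>i. f i \<in> borel_measurable M"
  shows "(\<lambda>x. \<chi> i. f i x) \<in> borel_measurable M"
proof (rule borel_measurable_euclidean_space[THEN iffD2], rule ballI)
  fix b :: "real^'d" assume "b \<in> Basis"
  then obtain i where "b = axis i 1" by (auto simp: Basis_vec_def)
  with assms show "(\<lambda>x. (\<chi> i. f i x) \<bullet> b) \<in> borel_measurable M"
    by (simp add: inner_axis)
qed

text \<open>Lebesgue measure is determined by its values on boxes, and both measures give a box the
  product of its side lengths. This makes the product-integral results for \<open>PiM\<close>
  available on vectors.\<close>

lemma lborel_eq_distr_PiM:
  "(lborel :: (real^'d) measure) = distr (\<Pi>\<^sub>M i\<in>UNIV. lborel) borel (\<lambda>y. \<chi> i. y i)"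
proof (rule lborel_eqI)
  interpret product_sigma_finite "\<lambda>i::'d. lborel :: real measure" by standard
  fix a b :: "real^'d" assume ab: "\<And>e. e \<in> Basis \<Longrightarrow> a \<bullet> e \<le> b \<bullet> e"
  have le: "a $ i \<le> b $ i" for i
    using ab[of "axis i 1"] by (simp add: inner_axis axis_in_Basis_iff)
  have m: "(\<lambda>y. \<chi> i. y i) \<in> (\<Pi>\<^sub>M i\<in>UNIV. lborel) \<rightarrow>\<^sub>M (borel :: (real^'d) measure)"
    by (rule borel_measurable_vec_lambda) measurable
  have "(\<lambda>y. (\<chi> i. y i) :: real^'d) -` box a b \<inter> space (\<Pi>\<^sub>M i\<in>UNIV. lborel) = (\<Pi>\<^sub>E i\<in>UNIV. {a $ i <..< b $ i})"
    by (auto simp: space_PiM mem_box_cart PiE_def Pi_def)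
  then have "emeasure (distr (\<Pi>\<^sub>M i\<in>UNIV. lborel) borel (\<lambda>y. \<chi> i. y i)) (box a b) = (\<Prod>i\<in>UNIV. ennreal (b $ i - a $ i))"
    using le by (simp add: emeasure_distr[OF m] emeasure_PiM)
  also have "\<dots> = ennreal (\<Prod>i\<in>UNIV. b $ i - a $ i)"
    using le by (intro prod_ennreal) auto
  also have "(\<Prod>i\<in>UNIV. b $ i - a $ i) = (\<Prod>e\<in>Basis. (b - a) \<bullet> e)"
  proof -
    have B: "(Basis :: (real^'d) set) = range (\<lambda>i. axis i 1)"
      by (auto simp: Basis_vec_def)
    have "inj (\<lambda>i::'d. axis i (1::real))"
      by (auto simp: inj_on_def axis_eq_axis)
    then show ?thesis
      unfolding B by (simp add: prod.reindex inner_axis)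
  qed
  finally show "emeasure (distr (\<Pi>\<^sub>M i\<in>UNIV. lborel) borel (\<lambda>y. \<chi> i. y i)) (box a b) = (\<Prod>e\<in>Basis. (b - a) \<bullet> e)" .
qed simp

lemma integrable_mollifier:
  assumes K: "integrable lborel K" and d: "0 < d"
  shows "integrable lborel (mollifier K d :: real^'d \<Rightarrow> real)"
proof -
  interpret product_sigma_finite "\<lambda>i::'d. lborel :: real measure" by standard
  have m: "(\<lambda>y. \<chi> i. y i) \<in> (\<Pi>\<^sub>M i\<in>UNIV. lborel) \<rightarrow>\<^sub>M (borel :: (real^'d) measure)"
    by (rule borel_measurable_vec_lambda) measurable
  have [measurable]: "K \<in> borel_measurable borel" using K by auto
  have s: "integrable lborel (\<lambda>x. K (x / d))"
    using lborel_integrable_real_affine[OF K, of "1 / d" 0] d by simp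
  have "integrable (\<Pi>\<^sub>M i\<in>UNIV. lborel) (\<lambda>y. 1 / d ^ CARD('d) * (\<Prod>i::'d\<in>UNIV. K (y i / d)))"
    using product_integrable_prod[of UNIV "\<lambda>_ s. K (s / d)"] s by simp
  then show ?thesis
    unfolding mollifier_def lborel_eq_distr_PiM
    by (subst integrable_distr_eq[OF m]) simp_all
qed

text \<open>This is the substitution \<open>a = x - c *\<^sub>R z\<close>, with Jacobian
  \<open>c ^ CARD('d)\<close>. Taking \<open>c = d\<close> removes the scaling of the mollifier;
  taking \<open>c = 1\<close> reflects the convolution variable.\<close>

lemma lborel_affine_reflect:
  fixes f :: "real^'d \<Rightarrow> real" and c :: real
  assumes c: "0 < c" and f[measurable]: "f \<in> borel_measurable borel"
  shows "(\<integral>a. f a \<partial>lborel) = c ^ CARD('d) * (\<integral>z. f (x - c *\<^sub>R z) \<partial>lborel)"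
    and "integrable lborel f \<Longrightarrow> integrable lborel (\<lambda>z. f (x - c *\<^sub>R z))"
proof -
  have eq: "(lborel :: (real^'d) measure) =
      density (distr lborel borel (\<lambda>z. x - c *\<^sub>R z)) (\<lambda>_. ennreal (c ^ CARD('d)))"
    using lborel_affine[of "- c" x] c by simp
  show "(\<integral>a. f a \<partial>lborel) = c ^ CARD('d) * (\<integral>z. f (x - c *\<^sub>R z) \<partial>lborel)"
    using c by (subst eq) (simp add: integral_density integral_distr)
  assume "integrable lborel f"
  then have "integrable (density (distr lborel borel (\<lambda>z. x - c *\<^sub>R z)) (\<lambda>_. ennreal (c ^ CARD('d)))) f"
    by (subst (asm) eq)
  then show "integrable lborel (\<lambda>z. f (x - c *\<^sub>R z))"
    using c by (subst (asm) integrable_density) (simp_all add: integrable_distr_eq)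
qed

lemma borel_measurable_mollifier[measurable]:
  assumes [measurable]: "K \<in> borel_measurable borel"
  shows "(mollifier K d :: real^'d \<Rightarrow> real) \<in> borel_measurable borel"
  unfolding mollifier_def by measurable

lemma convolve_integrable:
  assumes f: "f \<in> borel_measurable borel" "\<And>x. \<bar>f x\<bar> \<le> R"
    and K: "integrable lborel K" and d: "0 < d"
  shows "integrable lborel (\<lambda>a. f a * mollifier K d (x - a :: real^'d))"
proof -
  have "integrable lborel (\<lambda>a. mollifier K d (x - 1 *\<^sub>R a :: real^'d))"
    using integrable_mollifier[OF K d] by (intro lborel_affine_reflect) auto
  with f show ?thesis
    by (intro integrable_bounded_mult) auto
qed

text \<open>The reflection \<open>a \<mapsto> x - a\<close> exchanges the factors. It matches the
  invariance assumption of the third assertion, where the mollifier comes first, with the error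
  estimates, where it comes second.\<close>

lemma convolve_mollifier_commute:
  fixes f :: "real^'d \<Rightarrow> real"
  assumes [measurable]: "f \<in> borel_measurable borel" "K \<in> borel_measurable borel"
  shows "convolve (mollifier K d) f x = convolve f (mollifier K d) x"
  unfolding convolve_def
  by (subst lborel_affine_reflect(1)[of 1 _ x]) (simp_all add: mult.commute)

section \<open>Smoothing in one coordinate after the other\<close>

text \<open>Only the coordinates in \<open>I\<close> are smoothed, so that an induction on
  \<open>I\<close> leads from \<open>f\<close> itself at the empty set to the full convolution at
  \<open>UNIV\<close>. The variables are already rescaled: \<open>d\<close> enters through the
  argument of \<open>f\<close> and not through the kernel.\<close>

definition partial_smoothing :: "(real \<Rightarrow> real) \<Rightarrow> real \<Rightarrow> 'd set \<Rightarrow> (real^'d \<Rightarrow> real) \<Rightarrow> real^'d \<Rightarrow> real" where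
  "partial_smoothing K d I f x =
    (\<integral>y. f (x - (\<Sum>j\<in>I. (d * y j) *\<^sub>R axis j 1)) * (\<Prod>j\<in>I. K (y j)) \<partial>(\<Pi>\<^sub>M j\<in>I. lborel))"

text \<open>Under the substitution \<open>a = x - d *\<^sub>R z\<close> the Jacobian cancels the
  normalising factor of the mollifier, and the integral over vectors becomes one over coordinate
  functions.\<close>

lemma convolve_mollifier_eq_partial_smoothing:
  fixes f :: "real^'d \<Rightarrow> real"
  assumes [measurable]: "f \<in> borel_measurable borel" "K \<in> borel_measurable borel" and d: "0 < d"
  shows "convolve f (mollifier K d) x = partial_smoothing K d UNIV f x"
proof -
  have m: "(\<lambda>y. \<chi> i. y i) \<in> (\<Pi>\<^sub>M i\<in>UNIV. lborel) \<rightarrow>\<^sub>M (borel :: (real^'d) measure)"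
    by (rule borel_measurable_vec_lambda) measurable
  have eq: "d *\<^sub>R (\<chi> i. y i) = (\<Sum>i\<in>UNIV. (d * y i) *\<^sub>R axis i 1)" for y :: "'d \<Rightarrow> real"
    by (simp add: vec_eq_iff axis_def if_distrib sum.delta cong: if_cong)
  have "convolve f (mollifier K d) x =
      d ^ CARD('d) * (\<integral>z. f (x - d *\<^sub>R z) * mollifier K d (d *\<^sub>R z) \<partial>lborel)"
    unfolding convolve_def using d by (subst lborel_affine_reflect(1)[of d _ x]) simp_all
  also have "\<dots> = (\<integral>z. f (x - d *\<^sub>R z) * (\<Prod>i\<in>UNIV. K (z $ i)) \<partial>lborel)"
    using d unfolding mollifier_def by (subst integral_mult_right_zero[symmetric]) (simp add: mult_ac)
  also have "\<dots> = (\<integral>y. f (x - d *\<^sub>R (\<chi> i. y i)) * (\<Prod>i\<in>UNIV. K (y i)) \<partial>(\<Pi>\<^sub>M i\<in>UNIV. lborel))"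
    unfolding lborel_eq_distr_PiM by (subst integral_distr[OF m]) simp_all
  finally show ?thesis
    unfolding eq partial_smoothing_def .
qed

text \<open>The error telescopes. Smoothing in one more coordinate \<open>i\<close> replaces
  \<open>f\<close> by its line smoothing \<open>?g\<close> under the integral over \<open>I\<close>.
  The two differ by at most \<open>C\<close>, and integrating against the product of the
  \<open>\<bar>K\<bar>\<close> costs a factor \<open>?A\<close> for each coordinate in
  \<open>I\<close>.\<close>

lemma smoothing_error_partial:
  fixes f :: "real^'d \<Rightarrow> real"
  assumes f: "f \<in> borel_measurable borel" "\<And>x. \<bar>f x\<bar> \<le> R"
    and K: "integrable lborel K" "1 \<le> (\<integral>s. \<bar>K s\<bar> \<partial>lborel)" and C: "0 \<le> C"
    and line: "\<And>x i. \<bar>(\<integral>s. f (x - (d * s) *\<^sub>R axis i 1) * K s \<partial>lborel) - f x\<bar> \<le> C"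
  shows "\<bar>partial_smoothing K d I f x - f x\<bar> \<le> real (card I) * (C * (\<integral>s. \<bar>K s\<bar> \<partial>lborel) ^ CARD('d))"
proof (induction I rule: finite_induct[OF finite])
  case 1
  \<comment> \<open>Over the empty index set \<open>PiM\<close> is a one-point space of mass 1, so
    the integral is \<open>f x\<close>.\<close>
  show ?case by (simp add: partial_smoothing_def PiM_empty lebesgue_integral_count_space_finite)
next
  case (2 i I)
  interpret product_sigma_finite "\<lambda>i::'d. lborel :: real measure" by standard
  note [measurable] = f(1) borel_measurable_integrable[OF K(1)]
  let ?A = "\<integral>s. \<bar>K s\<bar> \<partial>lborel"
  let ?x = "\<lambda>y. x - (\<Sum>j\<in>I. (d * y j) *\<^sub>R axis j 1)"
  let ?P = "\<lambda>y. \<Prod>j\<in>I. K (y j)"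
  let ?g = "\<lambda>x. \<integral>s. f (x - (d * s) *\<^sub>R axis i 1) * K s \<partial>lborel"
  have int: "integrable (\<Pi>\<^sub>M j\<in>J. lborel) (\<lambda>y. f (x - (\<Sum>j\<in>J. (d * y j) *\<^sub>R axis j 1)) * (\<Prod>j\<in>J. K (y j)))" for J
  proof (rule integrable_bounded_mult)
    show "integrable (\<Pi>\<^sub>M j\<in>J. lborel) (\<lambda>y. \<Prod>j\<in>J. K (y j))"
      using K(1) by (intro product_integrable_prod) simp_all
  qed (measurable, rule f(2))
  have [measurable]: "?g \<in> borel_measurable borel"
    by measurable
  have g: "\<bar>?g z - f z\<bar> \<le> C" for z by (rule line)
  \<comment> \<open>This crude bound serves only the integrability of \<open>?g\<close> against the
    product of kernels.\<close>
  have g': "\<bar>?g z\<bar> \<le> C + R" for z using g[of z] f(2)[of z] by arith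
  have intg: "integrable (\<Pi>\<^sub>M j\<in>I. lborel) (\<lambda>y. ?g (?x y) * ?P y)"
  proof (rule integrable_bounded_mult)
    show "integrable (\<Pi>\<^sub>M j\<in>I. lborel) ?P"
      using K(1) by (intro product_integrable_prod) simp_all
  qed (measurable, rule g')
  \<comment> \<open>Fubini: coordinate \<open>i\<close> is integrated in the inner integral, which
    will become \<open>?g\<close>.\<close>
  have "partial_smoothing K d (insert i I) f x =
      (\<integral>y. (\<integral>s. f (x - (\<Sum>j\<in>insert i I. (d * (y(i := s)) j) *\<^sub>R axis j 1)) * (\<Prod>j\<in>insert i I. K ((y(i := s)) j)) \<partial>lborel) \<partial>(\<Pi>\<^sub>M j\<in>I. lborel))"
    unfolding partial_smoothing_def using 2 int by (intro product_integral_insert)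
  also have "\<dots> = (\<integral>y. ?g (?x y) * ?P y \<partial>(\<Pi>\<^sub>M j\<in>I. lborel))"
  proof (intro Bochner_Integration.integral_cong refl)
    fix y
    have "(\<Sum>j\<in>I. (d * (y(i := s)) j) *\<^sub>R axis j (1::real)) = (\<Sum>j\<in>I. (d * y j) *\<^sub>R axis j 1)"
         "(\<Prod>j\<in>I. K ((y(i := s)) j)) = ?P y" for s
      using 2 by (auto intro!: sum.cong prod.cong)
    then have "f (x - (\<Sum>j\<in>insert i I. (d * (y(i := s)) j) *\<^sub>R axis j 1)) * (\<Prod>j\<in>insert i I. K ((y(i := s)) j)) =
        f (?x y - (d * s) *\<^sub>R axis i 1) * K s * ?P y" for s
      using 2 by (simp add: algebra_simps)
    then show "(\<integral>s. f (x - (\<Sum>j\<in>insert i I. (d * (y(i := s)) j) *\<^sub>R axis j 1)) * (\<Prod>j\<in>insert i I. K ((y(i := s)) j)) \<partial>lborel)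
        = ?g (?x y) * ?P y"
      by simp
  qed
  finally have eq: "partial_smoothing K d (insert i I) f x - partial_smoothing K d I f x =
      (\<integral>y. ?g (?x y) * ?P y - f (?x y) * ?P y \<partial>(\<Pi>\<^sub>M j\<in>I. lborel))"
    unfolding partial_smoothing_def using int intg by simp
  have "\<bar>partial_smoothing K d (insert i I) f x - partial_smoothing K d I f x\<bar> \<le> (\<integral>y. \<bar>?g (?x y) * ?P y - f (?x y) * ?P y\<bar> \<partial>(\<Pi>\<^sub>M j\<in>I. lborel))"
    unfolding eq by (rule integral_abs_bound)
  also have "\<dots> \<le> (\<integral>y. C * (\<Prod>j\<in>I. \<bar>K (y j)\<bar>) \<partial>(\<Pi>\<^sub>M j\<in>I. lborel))"
  proof (rule integral_mono)
    fix y
    show "\<bar>?g (?x y) * ?P y - f (?x y) * ?P y\<bar> \<le> C * (\<Prod>j\<in>I. \<bar>K (y j)\<bar>)"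
      using g[of "?x y"] unfolding left_diff_distrib[symmetric] abs_mult abs_prod
      by (intro mult_right_mono prod_nonneg) auto
    show "integrable (\<Pi>\<^sub>M j\<in>I. lborel) (\<lambda>y. \<bar>?g (?x y) * ?P y - f (?x y) * ?P y\<bar>)"
      by (intro integrable_abs Bochner_Integration.integrable_diff intg int)
    show "integrable (\<Pi>\<^sub>M j\<in>I. lborel) (\<lambda>y. C * (\<Prod>j\<in>I. \<bar>K (y j)\<bar>))"
      using K(1) by (intro integrable_mult_right product_integrable_prod integrable_abs) simp_all
  qed
  also have "\<dots> = C * ?A ^ card I"
    using K(1) 2(1) product_integral_prod[of I "\<lambda>_ s. \<bar>K s\<bar>"] by simp
  \<comment> \<open>As \<open>?A\<close> is at least 1, the exponent can be raised to a value common
    to all steps, so that the increments sum to a multiple of the number of coordinates.\<close>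
  also have "\<dots> \<le> C * ?A ^ CARD('d)"
    using K(2) C by (intro mult_left_mono power_increasing card_mono) auto
  finally show ?case
    using 2(3) by (simp add: 2(1,2) distrib_right)
qed

lemma smoothing_error:
  fixes f :: "real^'d \<Rightarrow> real"
  assumes f: "f \<in> holder_space l \<alpha>" and n: "holder_norm l \<alpha> f \<le> ennreal R" and R: "0 \<le> R" and \<alpha>: "0 \<le> \<alpha>"
    and K: "kernel_of_order l K" and KI: "integrable lborel (\<lambda>s. \<bar>s\<bar> powr (real l + \<alpha>) * \<bar>K s\<bar>)" and d: "0 < d"
  shows "\<bar>convolve f (mollifier K d) x - f x\<bar> \<le>
    real CARD('d) * (\<integral>s. \<bar>K s\<bar> \<partial>lborel) ^ CARD('d) * R * (\<integral>s. \<bar>s\<bar> powr (real l + \<alpha>) * \<bar>K s\<bar> \<partial>lborel)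
      * d powr (real l + \<alpha>)"
proof -
  note KD = kernel_of_orderD[OF K]
  have "\<bar>partial_smoothing K d UNIV f x - f x\<bar> \<le> real CARD('d) *
      ((R * d powr (real l + \<alpha>) * (\<integral>s. \<bar>s\<bar> powr (real l + \<alpha>) * \<bar>K s\<bar> \<partial>lborel)) * (\<integral>s. \<bar>K s\<bar> \<partial>lborel) ^ CARD('d))"
  proof (rule smoothing_error_partial)
    show "0 \<le> R * d powr (real l + \<alpha>) * (\<integral>s. \<bar>s\<bar> powr (real l + \<alpha>) * \<bar>K s\<bar> \<partial>lborel)"
      using R by (intro mult_nonneg_nonneg integral_nonneg) simp_all
    show "\<bar>f z\<bar> \<le> R" for z
      by (rule abs_le_of_holder_norm_le[OF n R])
  qed (use holder_spaceD(3)[OF f] KD(2,6) smoothing_error_line[OF f n R \<alpha> K KI d] in auto)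
  then show ?thesis
    unfolding convolve_mollifier_eq_partial_smoothing[OF holder_spaceD(3)[OF f] KD(1) d]
    by (simp only: mult_ac)
qed

text \<open>Resting on the integrability of \<open>K\<close> alone, this bound keeps the supremum of
  the smoothing error finite for every \<open>n\<close>, even if the absolute moment of order
  \<beta> diverges.\<close>

lemma abs_convolve_mollifier_le:
  fixes f :: "real^'d \<Rightarrow> real"
  assumes f: "f \<in> borel_measurable borel" "\<And>x. \<bar>f x\<bar> \<le> R"
    and K: "integrable lborel K" and d: "0 < d"
  shows "\<bar>convolve f (mollifier K d) x\<bar> \<le> R * (\<integral>a. \<bar>mollifier K d (a :: real^'d)\<bar> \<partial>lborel)"
proof -
  have m: "integrable lborel (\<lambda>a. mollifier K d (x - a))"
    using lborel_affine_reflect(2)[of 1 "mollifier K d" x] integrable_mollifier[OF K d, where 'd = 'd]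
    by (simp add: borel_measurable_integrable)
  have "\<bar>convolve f (mollifier K d) x\<bar> \<le> (\<integral>a. R * \<bar>mollifier K d (x - a)\<bar> \<partial>lborel)"
    unfolding convolve_def
  proof (rule integral_abs_bound_integral)
    show "\<bar>f a * mollifier K d (x - a)\<bar> \<le> R * \<bar>mollifier K d (x - a)\<bar>" for a
      unfolding abs_mult by (intro mult_right_mono f(2) abs_ge_zero)
  qed (use m convolve_integrable[OF f K d, of x] in simp_all)
  also have "(\<integral>a. R * \<bar>mollifier K d (x - a)\<bar> \<partial>lborel) = R * (\<integral>a. \<bar>mollifier K d (a :: real^'d)\<bar> \<partial>lborel)"
    using lborel_affine_reflect(1)[of 1 "\<lambda>a :: real^'d. \<bar>mollifier K d a\<bar>" x]
      integrable_mollifier[OF K d, where 'd = 'd] by simp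
  finally show ?thesis .
qed

section \<open>Measurability of random functions\<close>

lemma
  shows space_holder_borel: "space (holder_borel l \<alpha> :: (real^'d \<Rightarrow> real) measure) = holder_space l \<alpha>"
    and sets_holder_borel:
      "openin (Metric_space.mtopology (holder_space l \<alpha>) (holder_dist l \<alpha>)) U \<Longrightarrow>
        U \<in> sets (holder_borel l \<alpha> :: (real^'d \<Rightarrow> real) measure)"
proof -
  interpret Metric_space "holder_space l \<alpha> :: (real^'d \<Rightarrow> real) set" "holder_dist l \<alpha>"
    by (rule Metric_space_holder)
  have "Collect (openin mtopology) \<subseteq> Pow (holder_space l \<alpha> :: (real^'d \<Rightarrow> real) set)"
    using openin_subset by fastforce
  note sigma = sets_measure_of[OF this] space_measure_of[OF this]
  show "space (holder_borel l \<alpha> :: (real^'d \<Rightarrow> real) measure) = holder_space l \<alpha>"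
    by (simp add: holder_borel_def sigma(2))
  show "openin mtopology U \<Longrightarrow> U \<in> sets (holder_borel l \<alpha>)"
    by (simp add: holder_borel_def sigma(1))
qed

text \<open>Evaluation is 1-Lipschitz for the Hoelder distance, which dominates the supremum norm of
  \<open>f - g\<close>; hence preimages of open sets are open in the metric topology.\<close>

lemma borel_measurable_holder_evaluation:
  "(\<lambda>f :: real^'d \<Rightarrow> real. f x) \<in> borel_measurable (holder_borel l \<alpha>)"
proof (rule borel_measurableI)
  interpret Metric_space "holder_space l \<alpha> :: (real^'d \<Rightarrow> real) set" "holder_dist l \<alpha>"
    by (rule Metric_space_holder)
  fix S :: "real set" assume S: "open S"
  have "openin mtopology {f \<in> holder_space l \<alpha>. f x \<in> S}"
    unfolding openin_mtopology
  proof (intro conjI allI impI)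
    fix f assume "f \<in> {f \<in> holder_space l \<alpha>. f x \<in> S}"
    then have f: "f \<in> holder_space l \<alpha>" "f x \<in> S" by auto
    from S f(2) obtain r where r: "0 < r" "\<And>y. dist y (f x) < r \<Longrightarrow> y \<in> S"
      unfolding open_dist by blast
    have "g x \<in> S" if g: "g \<in> mball f r" for g
    proof -
      from g have "g \<in> holder_space l \<alpha>" "holder_dist l \<alpha> f g < r" by auto
      moreover from this f have "ennreal \<bar>f x - g x\<bar> \<le> ennreal (holder_dist l \<alpha> f g)"
        using abs_le_holder_norm[of "\<lambda>x. f x - g x" x l \<alpha>] holder_norm_diff_finite[OF f(1), of g]
        by (simp add: holder_dist_def)
      then have "\<bar>f x - g x\<bar> \<le> holder_dist l \<alpha> f g"
        by simp
      ultimately show ?thesis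
        by (intro r(2)) (simp add: dist_real_def abs_minus_commute)
    qed
    with r(1) show "\<exists>r>0. mball f r \<subseteq> {f \<in> holder_space l \<alpha>. f x \<in> S}"
      by auto
  qed auto
  moreover have "(\<lambda>f. f x) -` S \<inter> space (holder_borel l \<alpha>) = {f \<in> holder_space l \<alpha>. f x \<in> S}"
    by (auto simp: space_holder_borel)
  ultimately show "(\<lambda>f. f x) -` S \<inter> space (holder_borel l \<alpha>) \<in> sets (holder_borel l \<alpha> :: (real^'d \<Rightarrow> real) measure)"
    by (simp add: sets_holder_borel)
qed

text \<open>The second argument is replaced by simple approximations \<open>s i\<close> of the
  identity. Each approximant involves finitely many sections, whence its measurability, and
  continuity carries this to the limit.\<close>

lemma borel_measurable_caratheodory:
  fixes F :: "'w \<Rightarrow> 'a :: {metric_space, second_countable_topology} \<Rightarrow> real"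
  assumes m: "\<And>x. (\<lambda>\<omega>. F \<omega> x) \<in> borel_measurable M"
    and c: "\<And>\<omega>. \<omega> \<in> space M \<Longrightarrow> continuous_on UNIV (F \<omega>)"
  shows "(\<lambda>p. F (fst p) (snd p)) \<in> borel_measurable (M \<Otimes>\<^sub>M borel)"
proof -
  obtain s :: "nat \<Rightarrow> 'a \<Rightarrow> 'a"
    where s: "\<And>i. simple_function borel (s i)" "\<And>x. (\<lambda>i. s i x) \<longlonglongrightarrow> x"
    using borel_measurable_implies_sequence_metric[of "\<lambda>x::'a. x" borel undefined] by auto
  show ?thesis
  proof (rule borel_measurable_LIMSEQ_real)
    fix p assume "p \<in> space (M \<Otimes>\<^sub>M (borel :: 'a measure))"
    then have "fst p \<in> space M" by (auto simp: space_pair_measure)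
    from c[OF this] have "isCont (F (fst p)) (snd p)"
      by (simp add: continuous_on_eq_continuous_at)
    then show "(\<lambda>i. F (fst p) (s i (snd p))) \<longlonglongrightarrow> F (fst p) (snd p)"
      using s(2) by (rule isCont_tendsto_compose)
  next
    fix i
    have fin: "finite (range (s i))" and "s i \<in> borel \<rightarrow>\<^sub>M count_space (range (s i))"
      using s(1)[of i] by (auto simp: simple_function_def measurable_count_space_eq2)
    then have "(\<lambda>p. s i (snd p)) \<in> M \<Otimes>\<^sub>M borel \<rightarrow>\<^sub>M count_space (range (s i))"
      by (intro measurable_compose[OF measurable_snd])
    then show "(\<lambda>p. F (fst p) (s i (snd p))) \<in> borel_measurable (M \<Otimes>\<^sub>M borel)"
      by (rule measurable_compose_countable'[rotated])
         (use measurable_compose[OF measurable_fst m] fin in \<open>auto intro: countable_finite\<close>)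
  qed
qed

section \<open>Estimates for positive parts and weighted averages\<close>

text \<open>Since \<open>ennreal\<close> sends negative numbers to 0, the right side integrates the
  positive part of \<open>f\<close>.\<close>

lemma ennreal_integral_le_nn_integral:
  assumes "integrable M f"
  shows "ennreal (\<integral>x. f x \<partial>M) \<le> (\<integral>\<^sup>+x. ennreal (f x) \<partial>M)"
proof -
  have "ennreal (\<integral>x. f x \<partial>M) \<le> ennreal (\<integral>x. max 0 (f x) \<partial>M)"
    using assms by (intro ennreal_leI integral_mono) auto
  also have "\<dots> = (\<integral>\<^sup>+x. ennreal (max 0 (f x)) \<partial>M)"
    using assms by (subst nn_integral_eq_integral) auto
  finally show ?thesis
    by (simp add: ennreal_max_0)
qed

text \<open>The points \<open>x j\<close>, \<open>x' j\<close> are the values of \<open>\<xi> n j\<close>, \<open>\<xi>' n j\<close> at one outcome. Taking \<open>h = V n \<omega>\<close> gives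
  the integrand of \<^const>\<open>E_diff\<close>, and the shifted mollifiers give the variable in \<^const>\<open>P_exceed\<close>.\<close>

definition weighted_diff ::
  "nat \<Rightarrow> real \<Rightarrow> ('a \<Rightarrow> real) \<Rightarrow> (nat \<Rightarrow> 'a) \<Rightarrow> (nat \<Rightarrow> 'a) \<Rightarrow> ('a \<Rightarrow> real) \<Rightarrow> real" where
  "weighted_diff n \<epsilon> \<psi> x x' h =
     1 / real n * (\<Sum>j=1..n. h (x' j) * \<psi> (x' j)) - (1 + \<epsilon>) * (1 / real n) * (\<Sum>j=1..n. h (x j) * \<psi> (x j))"

lemma weighted_diff_minus:
  "weighted_diff n \<epsilon> \<psi> x x' (\<lambda>y. f y - g y) = weighted_diff n \<epsilon> \<psi> x x' f - weighted_diff n \<epsilon> \<psi> x x' g"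
  by (simp add: weighted_diff_def left_diff_distrib right_diff_distrib sum_subtractf)

lemma weighted_diff_mult:
  "weighted_diff n \<epsilon> \<psi> x x' (\<lambda>y. c * f y) = c * weighted_diff n \<epsilon> \<psi> x x' f"
  by (simp add: weighted_diff_def right_diff_distrib sum_distrib_left mult_ac)

text \<open>\<open>weighted_diff\<close> is a finite linear combination of point evaluations of its
  last argument, so it commutes with integration over a parameter.\<close>

lemma
  assumes "\<And>y. integrable M (\<lambda>a. f a y)"
  shows integrable_weighted_diff: "integrable M (\<lambda>a. weighted_diff n \<epsilon> \<psi> x x' (f a))"
    and integral_weighted_diff:
      "(\<integral>a. weighted_diff n \<epsilon> \<psi> x x' (f a) \<partial>M) = weighted_diff n \<epsilon> \<psi> x x' (\<lambda>y. \<integral>a. f a y \<partial>M)"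
proof -
  have i: "integrable M (\<lambda>a. \<Sum>j=1..n. f a (z j) * \<psi> (z j))" for z
    using assms by (intro Bochner_Integration.integrable_sum integrable_mult_left)
  then show "integrable M (\<lambda>a. weighted_diff n \<epsilon> \<psi> x x' (f a))"
    unfolding weighted_diff_def by (intro Bochner_Integration.integrable_diff integrable_mult_right)
  have "(\<integral>a. (\<Sum>j=1..n. f a (z j) * \<psi> (z j)) \<partial>M) = (\<Sum>j=1..n. (\<integral>a. f a (z j) \<partial>M) * \<psi> (z j))" for z
    using assms by (subst Bochner_Integration.integral_sum) (simp_all add: integrable_mult_left)
  with i show "(\<integral>a. weighted_diff n \<epsilon> \<psi> x x' (f a) \<partial>M) = weighted_diff n \<epsilon> \<psi> x x' (\<lambda>y. \<integral>a. f a y \<partial>M)"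
    unfolding weighted_diff_def
    by (subst Bochner_Integration.integral_diff) (simp_all add: integrable_mult_right)
qed

text \<open>Each average is at most \<open>c * sup_norm \<psi>\<close> in absolute value, and the
  weights 1 and \<open>1 + \<epsilon>\<close> add up to \<open>2 + \<epsilon>\<close>.\<close>

lemma weighted_diff_bound:
  assumes n: "1 \<le> n" and \<epsilon>: "0 \<le> \<epsilon>" and h: "\<And>y. ennreal \<bar>h y\<bar> \<le> c"
  shows "ennreal \<bar>weighted_diff n \<epsilon> \<psi> x x' h\<bar> \<le> ennreal (2 + \<epsilon>) * c * sup_norm \<psi>"
\<comment> \<open>Only the product has to be real: it is finite also for infinite \<open>c\<close>
  when \<psi> vanishes, as \<open>\<infinity> * 0 = 0\<close>. If the product is infinite, so is the
  right side.\<close>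
proof (cases "c * sup_norm \<psi>")
  case (real r)
  have b: "\<bar>h y * \<psi> y\<bar> \<le> r" for y
  proof -
    have "ennreal \<bar>h y * \<psi> y\<bar> = ennreal \<bar>h y\<bar> * ennreal \<bar>\<psi> y\<bar>"
      by (simp add: abs_mult ennreal_mult)
    also have "\<dots> \<le> c * sup_norm \<psi>"
      using h by (intro mult_mono) (auto simp: sup_norm_def intro: SUP_upper)
    finally show ?thesis using real by simp
  qed
  have s: "\<bar>1 / real n * (\<Sum>j=1..n. h (z j) * \<psi> (z j))\<bar> \<le> r" for z
  proof -
    have "\<bar>\<Sum>j=1..n. h (z j) * \<psi> (z j)\<bar> \<le> (\<Sum>j=1..n. r)"
      by (rule order_trans[OF sum_abs]) (intro sum_mono b)
    with n show ?thesis by (simp add: abs_mult field_simps)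
  qed
  have "\<bar>u - (1 + \<epsilon>) * v\<bar> \<le> (2 + \<epsilon>) * r" if "\<bar>u\<bar> \<le> r" "\<bar>v\<bar> \<le> r" for u v
  proof -
    have "\<bar>(1 + \<epsilon>) * v\<bar> \<le> (1 + \<epsilon>) * r"
      using that \<epsilon> by (simp add: abs_mult)
    with that(1) have "\<bar>u - (1 + \<epsilon>) * v\<bar> \<le> r + (1 + \<epsilon>) * r"
      by linarith
    then show ?thesis by (simp add: distrib_right)
  qed
  then have "ennreal \<bar>weighted_diff n \<epsilon> \<psi> x x' h\<bar> \<le> ennreal ((2 + \<epsilon>) * r)"
    unfolding weighted_diff_def mult.assoc using s by (intro ennreal_leI) (simp only: mult.assoc)
  also have "\<dots> = ennreal (2 + \<epsilon>) * (c * sup_norm \<psi>)"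
    using \<epsilon> real by (simp add: ennreal_mult)
  finally show ?thesis by (simp only: mult.assoc)
next
  case top
  then show ?thesis
    using \<epsilon> by (simp add: mult.assoc ennreal_mult_top)
qed

lemma ennreal_abs_mollifier_le:
  assumes "0 < d"
  shows "ennreal \<bar>mollifier K d (x :: real^'d)\<bar> \<le> ennreal (1 / d ^ CARD('d)) * sup_norm K ^ CARD('d)"
proof -
  have "ennreal (\<Prod>i\<in>UNIV. \<bar>K (x $ i / d)\<bar>) = (\<Prod>i\<in>UNIV. ennreal \<bar>K (x $ i / d)\<bar>)"
    by (simp add: prod_ennreal)
  also have "(\<Prod>i\<in>I. ennreal \<bar>K (x $ i / d)\<bar>) \<le> sup_norm K ^ card I" for I
    by (induction I rule: infinite_finite_induct)
       (auto simp: sup_norm_def intro!: mult_mono SUP_upper)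
  finally have "ennreal (\<Prod>i\<in>UNIV. \<bar>K (x $ i / d)\<bar>) \<le> sup_norm K ^ CARD('d)"
    by simp
  then have "ennreal (1 / d ^ CARD('d)) * ennreal (\<Prod>i\<in>UNIV. \<bar>K (x $ i / d)\<bar>) \<le>
      ennreal (1 / d ^ CARD('d)) * sup_norm K ^ CARD('d)"
    by (rule mult_left_mono) simp
  then show ?thesis
    using assms by (simp add: mollifier_def abs_mult abs_prod ennreal_mult[symmetric] prod_nonneg)
qed

text \<open>The positive part is at most \<open>c\<close> and vanishes where \<open>f\<close> is not
  positive. This is how a uniform bound on \<delta> turns its expectation into the probability
  \<open>P_exceed\<close>.\<close>

lemma nn_integral_pos_part_le:
  assumes "f \<in> borel_measurable M" "\<And>x. x \<in> space M \<Longrightarrow> ennreal (f x) \<le> c"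
  shows "(\<integral>\<^sup>+x. ennreal (f x) \<partial>M) \<le> c * emeasure M {x \<in> space M. 0 < f x}"
proof -
  have "(\<integral>\<^sup>+x. ennreal (f x) \<partial>M) \<le> (\<integral>\<^sup>+x. c * indicator {x \<in> space M. 0 < f x} x \<partial>M)"
    using assms(2) by (intro nn_integral_mono) (auto simp: indicator_def ennreal_neg)
  also have "\<dots> = c * emeasure M {x \<in> space M. 0 < f x}"
    using assms(1) by (intro nn_integral_cmult_indicator) measurable
  finally show ?thesis .
qed

section \<open>Comparison of the two expectations\<close>

context smoothing_setting
begin

text \<open>Measurability into \<open>holder_borel\<close> confines the values to the space at every
  outcome, so joint measurability of \<open>V n\<close> involves no exceptional null set.\<close>

lemma V_in_holder_space: "1 \<le> n \<Longrightarrow> \<omega> \<in> space M \<Longrightarrow> V n \<omega> \<in> holder_space l \<alpha>"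
  using measurable_space[OF V_random] by (simp add: space_holder_borel)

lemma V_jointly_measurable:
  assumes "1 \<le> n"
  shows "(\<lambda>p. V n (fst p) (snd p)) \<in> borel_measurable (M \<Otimes>\<^sub>M borel)"
  using assms V_in_holder_space
  by (intro borel_measurable_caratheodory measurable_compose[OF V_random borel_measurable_holder_evaluation])
     (auto intro: holder_spaceD)

lemma integrable_V_psi:
  assumes n: "1 \<le> n" and \<eta>[measurable]: "random_variable borel \<eta>"
  shows "integrable M (\<lambda>\<omega>. V n \<omega> (\<eta> \<omega>) * \<psi> (\<eta> \<omega>))"
proof -
  note [measurable] = psi_measurable
  obtain R where R: "0 \<le> R" "\<And>f. f \<in> B \<Longrightarrow> holder_norm l \<alpha> f \<le> ennreal R"
    using holder_bounded_obtains[OF B_bounded] by metis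
  obtain C where C: "\<And>x. \<bar>\<psi> x\<bar> \<le> C"
    using psi_bounded by (auto simp: bounded_iff)
  have [measurable]: "(\<lambda>\<omega>. V n \<omega> (\<eta> \<omega>)) \<in> borel_measurable M"
    using measurable_compose[OF measurable_Pair[OF measurable_ident_sets[OF refl] \<eta>] V_jointly_measurable[OF n]]
    by simp
  show ?thesis
  proof (rule integrable_const_bound)
    show "AE \<omega> in M. norm (V n \<omega> (\<eta> \<omega>) * \<psi> (\<eta> \<omega>)) \<le> R * C"
      using V_in_B[OF n]
    proof eventually_elim
      case (elim \<omega>)
      have "\<bar>V n \<omega> (\<eta> \<omega>)\<bar> \<le> R"
        by (rule abs_le_of_holder_norm_le[OF R(2)[OF elim] R(1)])
      with C R(1) show ?case
        by (auto simp: abs_mult intro!: mult_mono)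
    qed
  qed measurable
qed

lemma E_diff_eq:
  assumes n: "1 \<le> n"
  shows "E_diff M V \<psi> \<xi> \<xi>' \<epsilon> n =
      (\<integral>\<omega>. weighted_diff n \<epsilon> \<psi> (\<lambda>j. \<xi> n j \<omega>) (\<lambda>j. \<xi>' n j \<omega>) (V n \<omega>) \<partial>M)" (is ?eq)
    and "integrable M (\<lambda>\<omega>. weighted_diff n \<epsilon> \<psi> (\<lambda>j. \<xi> n j \<omega>) (\<lambda>j. \<xi>' n j \<omega>) (V n \<omega>))" (is ?int)
proof -
  have i: "integrable M (\<lambda>\<omega>. \<Sum>j=1..n. V n \<omega> (\<xi> n j \<omega>) * \<psi> (\<xi> n j \<omega>))"
      "integrable M (\<lambda>\<omega>. \<Sum>j=1..n. V n \<omega> (\<xi>' n j \<omega>) * \<psi> (\<xi>' n j \<omega>))"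
    using xi_random xi'_random
    by (auto intro!: Bochner_Integration.integrable_sum integrable_V_psi[OF n])
  then show ?int
    unfolding weighted_diff_def by (intro Bochner_Integration.integrable_diff integrable_mult_right)
  show ?eq
    unfolding weighted_diff_def E_diff_def mult.assoc
    by (subst Bochner_Integration.integral_diff)
       (use i in \<open>auto simp only: integral_mult_right_zero intro!: integrable_mult_right\<close>)
qed

text \<open>The smoothing error is a parameter \<open>e\<close>, so that one estimate covers both
  inequalities: \<open>e\<close> is a multiple of \<open>d n powr \<beta>\<close> in general and 0
  if \<open>V n\<close> is invariant under smoothing. Values in \<open>ennreal\<close> admit an
  infinite \<open>sup_norm K\<close> or measure of \<open>X\<close>.\<close>

lemma E_diff_bound:
  assumes n: "1 \<le> n" and K: "integrable lborel K" and e: "0 \<le> e"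
    and err: "AE \<omega> in M. \<forall>x. \<bar>convolve (V n \<omega>) (mollifier K (d n)) x - V n \<omega> x\<bar> \<le> e"
  shows "ennreal (E_diff M V \<psi> \<xi> \<xi>' \<epsilon> n) \<le>
      ennreal 3 * sup_norm K ^ CARD('d) * emeasure lborel X * (SUP m\<in>{1..}. ess_sup_norm M (V m)) * sup_norm \<psi> *
        ennreal (1 / d n ^ CARD('d)) * (SUP a\<in>X. ennreal (P_exceed M K d \<psi> \<xi> \<xi>' \<epsilon> n a))
      + ennreal (3 * e) * sup_norm \<psi>
      + ennreal (2 + \<epsilon>) * ennreal (1 / d n ^ CARD('d)) * sup_norm K ^ CARD('d) * sup_norm \<psi> *
        (\<integral>\<^sup>+\<omega>. (\<integral>\<^sup>+a\<in>-X. ennreal (V n \<omega> a) \<partial>lborel) \<partial>M)"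
proof -
  note [measurable] = psi_measurable X_measurable borel_measurable_integrable[OF K]
  note dn = d_pos[OF n]
  have Vm[measurable]: "(\<lambda>p. V n (fst p) (snd p)) \<in> borel_measurable (M \<Otimes>\<^sub>M lborel)"
    using V_jointly_measurable[OF n] by (simp cong: measurable_cong_sets sets_pair_measure_cong)
  have xm[measurable]: "\<xi> n j \<in> borel_measurable M" "\<xi>' n j \<in> borel_measurable M" if "j \<in> {1..n}" for j
    using xi_random xi'_random that by auto
  define W where "W = weighted_diff n \<epsilon> \<psi>"
  define \<delta> where "\<delta> \<omega> a = W (\<lambda>j. \<xi> n j \<omega>) (\<lambda>j. \<xi>' n j \<omega>) (\<lambda>x. mollifier K (d n) (x - a))" for \<omega> a
  define v where "v = (SUP m\<in>{1..}. ess_sup_norm M (V m))"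
  \<comment> \<open>\<open>k\<close> bounds \<delta> uniformly; it combines the pointwise bound of
    the mollifier with \<open>weighted_diff_bound\<close>.\<close>
  define k where "k = ennreal (2 + \<epsilon>) * (ennreal (1 / d n ^ CARD('d)) * sup_norm K ^ CARD('d)) * sup_norm \<psi>"
  define p where "p = (SUP a\<in>X. ennreal (P_exceed M K d \<psi> \<xi> \<xi>' \<epsilon> n a))"
  have \<delta>m[measurable]: "(\<lambda>q. \<delta> (fst q) (snd q)) \<in> borel_measurable (M \<Otimes>\<^sub>M lborel)"
    unfolding \<delta>_def W_def weighted_diff_def by measurable
  have \<delta>_le: "ennreal (\<delta> \<omega> a) \<le> k" for \<omega> a
  proof -
    have "ennreal \<bar>\<delta> \<omega> a\<bar> \<le> k"
      unfolding \<delta>_def W_def k_def using n eps dn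
      by (intro weighted_diff_bound ennreal_abs_mollifier_le) auto
    then show ?thesis
      by (rule order_trans[rotated]) (simp add: ennreal_leI)
  qed
  have V_le: "AE \<omega> in M. \<forall>x. ennreal (V n \<omega> x) \<le> v"
    using esssup_AE[of "\<lambda>\<omega>. sup_norm (V n \<omega>)" M]
  proof eventually_elim
    case (elim \<omega>)
    have "ennreal (V n \<omega> x) \<le> sup_norm (V n \<omega>)" for x
      unfolding sup_norm_def by (rule SUP_upper2[of x]) (auto intro: ennreal_leI)
    also note elim
    also have "esssup M (\<lambda>\<omega>. sup_norm (V n \<omega>)) \<le> v"
      unfolding v_def ess_sup_norm_def[symmetric] using n by (intro SUP_upper) auto
    finally show ?case by blast
  qed
  have pointwise: "AE \<omega> in M. ennreal (W (\<lambda>j. \<xi> n j \<omega>) (\<lambda>j. \<xi>' n j \<omega>) (V n \<omega>)) \<le>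
      v * (\<integral>\<^sup>+a. ennreal (\<delta> \<omega> a) * indicator X a \<partial>lborel) + k * (\<integral>\<^sup>+a\<in>-X. ennreal (V n \<omega> a) \<partial>lborel)
      + ennreal (3 * e) * sup_norm \<psi>"
    using V_in_B[OF n] V_nonneg[OF n] V_le err AE_space
  proof eventually_elim
    case (elim \<omega>)
    let ?W = "W (\<lambda>j. \<xi> n j \<omega>) (\<lambda>j. \<xi>' n j \<omega>)"
    let ?c = "convolve (V n \<omega>) (mollifier K (d n))"
    obtain R where R: "0 \<le> R" "\<And>f. f \<in> B \<Longrightarrow> holder_norm l \<alpha> f \<le> ennreal R"
      using holder_bounded_obtains[OF B_bounded] by metis
    have Vb[measurable]: "V n \<omega> \<in> borel_measurable borel"
      using V_in_holder_space[OF n elim(5)] by (rule holder_spaceD)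
    have [measurable]: "(\<lambda>a. \<delta> \<omega> a) \<in> borel_measurable borel"
      unfolding \<delta>_def W_def weighted_diff_def by measurable
    have int: "integrable lborel (\<lambda>a. V n \<omega> a * mollifier K (d n) (x - a))" for x
      by (rule convolve_integrable[OF Vb abs_le_of_holder_norm_le[OF R(2)[OF elim(1)] R(1)] K dn])
    \<comment> \<open>By linearity the weighted difference moves inside the convolution integral.
      The factor \<open>V n \<omega> a\<close> does not depend on the averaged points and comes out,
      leaving \<open>\<delta> \<omega> a\<close>.\<close>
    have conv: "?W ?c = (\<integral>a. V n \<omega> a * \<delta> \<omega> a \<partial>lborel)"
      unfolding \<delta>_def W_def weighted_diff_mult[symmetric] convolve_def
      by (rule integral_weighted_diff[OF int, symmetric])
    have "integrable lborel (\<lambda>a. V n \<omega> a * \<delta> \<omega> a)"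
      unfolding \<delta>_def W_def weighted_diff_mult[symmetric] by (rule integrable_weighted_diff[OF int])
    then have "ennreal (?W ?c) \<le> (\<integral>\<^sup>+a. ennreal (V n \<omega> a * \<delta> \<omega> a) \<partial>lborel)"
      unfolding conv by (rule ennreal_integral_le_nn_integral)
    \<comment> \<open>On \<open>X\<close> the function is bounded by \<open>v\<close> and \<delta>
      is kept for the probability estimate; outside \<open>X\<close>, \<delta> is bounded by
      \<open>k\<close> and the function is kept.\<close>
    also have "\<dots> \<le> (\<integral>\<^sup>+a. v * (ennreal (\<delta> \<omega> a) * indicator X a) + k * (ennreal (V n \<omega> a) * indicator (-X) a) \<partial>lborel)"
    proof (rule nn_integral_mono)
      fix a
      have "ennreal (V n \<omega> a * \<delta> \<omega> a) = ennreal (V n \<omega> a) * ennreal (\<delta> \<omega> a)"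
        using elim(2) by (simp add: ennreal_mult')
      moreover have "ennreal (V n \<omega> a) * ennreal (\<delta> \<omega> a) \<le> v * ennreal (\<delta> \<omega> a)"
        using elim(3) by (intro mult_right_mono) auto
      moreover have "ennreal (V n \<omega> a) * ennreal (\<delta> \<omega> a) \<le> ennreal (V n \<omega> a) * k"
        using \<delta>_le by (intro mult_left_mono) auto
      ultimately show "ennreal (V n \<omega> a * \<delta> \<omega> a) \<le>
          v * (ennreal (\<delta> \<omega> a) * indicator X a) + k * (ennreal (V n \<omega> a) * indicator (-X) a)"
        by (auto simp: indicator_def mult.commute)
    qed
    also have "\<dots> = v * (\<integral>\<^sup>+a. ennreal (\<delta> \<omega> a) * indicator X a \<partial>lborel) + k * (\<integral>\<^sup>+a\<in>-X. ennreal (V n \<omega> a) \<partial>lborel)"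
      by (subst nn_integral_add, measurable) (subst (1 2) nn_integral_cmult, measurable)
    finally have main: "ennreal (?W ?c) \<le> \<dots>" .
    \<comment> \<open>The cost of replacing \<open>V n \<omega>\<close> by its smoothing is again a
      weighted difference, taken of a function bounded by \<open>e\<close>.\<close>
    have "ennreal \<bar>?W (\<lambda>x. ?c x - V n \<omega> x)\<bar> \<le> ennreal (2 + \<epsilon>) * ennreal e * sup_norm \<psi>"
      unfolding W_def using n eps elim(4) by (intro weighted_diff_bound ennreal_leI) auto
    also have "ennreal (2 + \<epsilon>) * ennreal e = ennreal ((2 + \<epsilon>) * e)"
      using eps e by (intro ennreal_mult[symmetric]) auto
    also have "ennreal ((2 + \<epsilon>) * e) * sup_norm \<psi> \<le> ennreal (3 * e) * sup_norm \<psi>"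
      using eps e by (intro mult_right_mono ennreal_leI) auto
    finally have error: "ennreal \<bar>?W (\<lambda>x. ?c x - V n \<omega> x)\<bar> \<le> ennreal (3 * e) * sup_norm \<psi>" .
    have "ennreal (?W (V n \<omega>)) \<le> ennreal (?W ?c + \<bar>?W (\<lambda>x. ?c x - V n \<omega> x)\<bar>)"
      by (rule ennreal_leI) (simp add: W_def weighted_diff_minus)
    also have "\<dots> \<le> ennreal (?W ?c) + ennreal \<bar>?W (\<lambda>x. ?c x - V n \<omega> x)\<bar>"
      by (cases "0 \<le> ?W ?c") (auto simp: ennreal_neg intro!: ennreal_leI)
    also note add_mono[OF main error]
    finally show ?case .
  qed
  have P: "(\<integral>\<^sup>+\<omega>. ennreal (\<delta> \<omega> a) \<partial>M) \<le> k * p" if "a \<in> X" for a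
  proof -
    have [measurable]: "(\<lambda>\<omega>. \<delta> \<omega> a) \<in> borel_measurable M"
      unfolding \<delta>_def W_def weighted_diff_def by measurable
    have "(\<integral>\<^sup>+\<omega>. ennreal (\<delta> \<omega> a) \<partial>M) \<le> k * emeasure M {\<omega> \<in> space M. 0 < \<delta> \<omega> a}"
      using \<delta>_le by (intro nn_integral_pos_part_le) auto
    also have "emeasure M {\<omega> \<in> space M. 0 < \<delta> \<omega> a} = ennreal (P_exceed M K d \<psi> \<xi> \<xi>' \<epsilon> n a)"
      by (simp add: P_exceed_def \<delta>_def W_def weighted_diff_def emeasure_eq_measure)
    also have "\<dots> \<le> p"
      unfolding p_def using that by (rule SUP_upper)
    finally show ?thesis by (simp add: mult_left_mono)
  qed
  \<comment> \<open>Exchanging the integrals places the expectation inside, where \<open>P\<close>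
    applies to each fixed \<open>a\<close> in \<open>X\<close>.\<close>
  have "(\<integral>\<^sup>+\<omega>. (\<integral>\<^sup>+a. ennreal (\<delta> \<omega> a) * indicator X a \<partial>lborel) \<partial>M) =
      (\<integral>\<^sup>+a. (\<integral>\<^sup>+\<omega>. ennreal (\<delta> \<omega> a) * indicator X a \<partial>M) \<partial>lborel)"
  proof -
    interpret pair_sigma_finite M "lborel :: (real^'d) measure" by standard
    show ?thesis
      by (rule Fubini'[symmetric]) (simp add: case_prod_unfold)
  qed
  also have "\<dots> \<le> (\<integral>\<^sup>+a. (k * p) * indicator X a \<partial>lborel)"
    using P by (intro nn_integral_mono) (auto simp: indicator_def)
  also have "\<dots> = k * p * emeasure lborel X"
    by (rule nn_integral_cmult_indicator) simp
  finally have fubini: "(\<integral>\<^sup>+\<omega>. (\<integral>\<^sup>+a. ennreal (\<delta> \<omega> a) * indicator X a \<partial>lborel) \<partial>M) \<le> k * p * emeasure lborel X" .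
  have m1[measurable]: "(\<lambda>\<omega>. \<integral>\<^sup>+a. ennreal (\<delta> \<omega> a) * indicator X a \<partial>lborel) \<in> borel_measurable M"
    by (rule lborel.borel_measurable_nn_integral) (simp add: case_prod_unfold)
  have m2[measurable]: "(\<lambda>\<omega>. \<integral>\<^sup>+a\<in>-X. ennreal (V n \<omega> a) \<partial>lborel) \<in> borel_measurable M"
    by (rule lborel.borel_measurable_nn_integral) (simp add: case_prod_unfold)
  have "ennreal (E_diff M V \<psi> \<xi> \<xi>' \<epsilon> n) \<le>
      (\<integral>\<^sup>+\<omega>. ennreal (W (\<lambda>j. \<xi> n j \<omega>) (\<lambda>j. \<xi>' n j \<omega>) (V n \<omega>)) \<partial>M)"
    unfolding E_diff_eq(1)[OF n] W_def
    by (rule ennreal_integral_le_nn_integral[OF E_diff_eq(2)[OF n]])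
  also have "\<dots> \<le> (\<integral>\<^sup>+\<omega>. v * (\<integral>\<^sup>+a. ennreal (\<delta> \<omega> a) * indicator X a \<partial>lborel)
      + k * (\<integral>\<^sup>+a\<in>-X. ennreal (V n \<omega> a) \<partial>lborel) + ennreal (3 * e) * sup_norm \<psi> \<partial>M)"
    using pointwise by (rule nn_integral_mono_AE)
  also have "\<dots> = v * (\<integral>\<^sup>+\<omega>. (\<integral>\<^sup>+a. ennreal (\<delta> \<omega> a) * indicator X a \<partial>lborel) \<partial>M)
      + k * (\<integral>\<^sup>+\<omega>. (\<integral>\<^sup>+a\<in>-X. ennreal (V n \<omega> a) \<partial>lborel) \<partial>M) + ennreal (3 * e) * sup_norm \<psi>"
    using m1 m2 by (simp add: nn_integral_add nn_integral_cmult emeasure_space_1)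
  also have "\<dots> \<le> v * (k * p * emeasure lborel X)
      + k * (\<integral>\<^sup>+\<omega>. (\<integral>\<^sup>+a\<in>-X. ennreal (V n \<omega> a) \<partial>lborel) \<partial>M) + ennreal (3 * e) * sup_norm \<psi>"
    using fubini by (intro add_mono mult_left_mono) auto
  also have "v * (k * p * emeasure lborel X) =
      ennreal (2 + \<epsilon>) * (sup_norm K ^ CARD('d) * emeasure lborel X * v * sup_norm \<psi> * ennreal (1 / d n ^ CARD('d)) * p)"
    unfolding k_def by (simp only: mult_ac)
  \<comment> \<open>Replacing \<open>2 + \<epsilon>\<close> by 3 frees the constant from
    \<epsilon>.\<close>
  also have "\<dots> \<le> ennreal 3 * (sup_norm K ^ CARD('d) * emeasure lborel X * v * sup_norm \<psi> * ennreal (1 / d n ^ CARD('d)) * p)"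
    using eps by (intro mult_right_mono ennreal_leI) auto
  finally show ?thesis
    unfolding k_def v_def p_def by (simp only: ac_simps add_mono order_refl)
qed

end

section \<open>Choice of the constants and assembly of the three assertions\<close>

theorem theorem2p1:
  fixes \<beta> :: real and l :: nat and K :: "real \<Rightarrow> real"
  assumes "\<beta> > 0"
    and "l = (GREATEST k::nat. real k < \<beta>)"
    and "kernel_of_order l K"
  shows
    "(\<forall>(B :: (real^'d \<Rightarrow> real) set) d.
        holder_bounded l (\<beta> - real l) B \<and> (\<forall>n\<ge>1. d n > 0) \<and> d \<longlonglongrightarrow> 0 \<longrightarrow>
        (\<forall>n\<ge>1. \<forall>f\<in>B. \<forall>x. integrable lborel (\<lambda>a. f a * mollifier K (d n) (x - a))) \<and>
        (\<exists>err :: nat \<Rightarrow> (real^'d \<Rightarrow> real) \<Rightarrow> real^'d \<Rightarrow> real.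
           (\<forall>n\<ge>1. \<forall>f\<in>B. \<forall>x. convolve f (mollifier K (d n)) x = f x + err n f x) \<and>
           (\<forall>n\<ge>1. (SUP f\<in>B. sup_norm (err n f)) < \<infinity>) \<and>
           (integrable lborel (\<lambda>x. \<bar>x\<bar> powr \<beta> * \<bar>K x\<bar>) \<longrightarrow>
              (\<lambda>n. enn2real (SUP f\<in>B. sup_norm (err n f))) \<in> O(\<lambda>n. d n powr \<beta>))))
     \<and>
     (\<exists>(C_X :: (real^'d) set \<Rightarrow> ennreal) (C_B :: (real^'d \<Rightarrow> real) set \<Rightarrow> ennreal).
        (\<forall>X. emeasure lborel X < \<infinity> \<and> sup_norm K < \<infinity> \<longrightarrow> C_X X < \<infinity>) \<and>
        (\<forall>B. integrable lborel (\<lambda>x. \<bar>x\<bar> powr \<beta> * \<bar>K x\<bar>) \<longrightarrow> C_B B < \<infinity>) \<and>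
        (\<forall>(M :: 'w measure) B X \<psi> \<xi> \<xi>' V d \<epsilon>.
           smoothing_setting M l (\<beta> - real l) B X \<psi> \<xi> \<xi>' V d \<epsilon> \<longrightarrow>
           (\<forall>n\<ge>1.
              ennreal (E_diff M V \<psi> \<xi> \<xi>' \<epsilon> n) \<le>
                C_X X * (SUP m\<in>{1..}. ess_sup_norm M (V m)) * sup_norm \<psi> *
                  ennreal (1 / d n ^ CARD('d)) * (SUP a\<in>X. ennreal (P_exceed M K d \<psi> \<xi> \<xi>' \<epsilon> n a))
                + C_B B * sup_norm \<psi> * ennreal (d n powr \<beta>)
                + ennreal (2 + \<epsilon>) * ennreal (1 / d n ^ CARD('d)) * sup_norm K ^ CARD('d) * sup_norm \<psi> *
                  (\<integral>\<^sup>+\<omega>. (\<integral>\<^sup>+a\<in>-X. ennreal (V n \<omega> a) \<partial>lborel) \<partial>M)) \<and>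
           (\<forall>n\<ge>1. (AE \<omega> in M. convolve (mollifier K (d n)) (V n \<omega>) = V n \<omega>) \<longrightarrow>
              ennreal (E_diff M V \<psi> \<xi> \<xi>' \<epsilon> n) \<le>
                C_X X * (SUP m\<in>{1..}. ess_sup_norm M (V m)) * sup_norm \<psi> *
                  ennreal (1 / d n ^ CARD('d)) * (SUP a\<in>X. ennreal (P_exceed M K d \<psi> \<xi> \<xi>' \<epsilon> n a))
                + ennreal (2 + \<epsilon>) * ennreal (1 / d n ^ CARD('d)) * sup_norm K ^ CARD('d) * sup_norm \<psi> *
                  (\<integral>\<^sup>+\<omega>. (\<integral>\<^sup>+a\<in>-X. ennreal (V n \<omega> a) \<partial>lborel) \<partial>M))))"
proof (intro conjI)
  let ?\<alpha> = "\<beta> - real l"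
  let ?KI = "integrable lborel (\<lambda>x. \<bar>x\<bar> powr \<beta> * \<bar>K x\<bar>)"
  \<comment> \<open>The greatest element exists because the set contains 0, by positivity of
    \<beta>, and is bounded above.\<close>
  have "real l < \<beta>"
    unfolding assms(2)
  proof (rule GreatestI_nat)
    show "real 0 < \<beta>" using assms(1) by simp
    show "k \<le> nat \<lceil>\<beta>\<rceil>" if "real k < \<beta>" for k using that by linarith
  qed
  then have \<alpha>: "0 \<le> ?\<alpha>" "real l + ?\<alpha> = \<beta>" by simp_all
  note K = assms(3) and KD = kernel_of_orderD[OF assms(3)]
  \<comment> \<open>\<open>SOME\<close> makes the norm bound a function of \<open>B\<close> alone:
    the constants have to be fixed before the probability space, the arrays and the sequence
    \<open>d\<close> are given.\<close>
  define R where "R B = (SOME R. 0 \<le> R \<and> B \<subseteq> holder_space l ?\<alpha> \<and> (\<forall>f\<in>B. holder_norm l ?\<alpha> f \<le> ennreal R))"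
    for B :: "(real^'d \<Rightarrow> real) set"
  have R: "0 \<le> R B" "\<And>f. f \<in> B \<Longrightarrow> f \<in> holder_space l ?\<alpha>" "\<And>f. f \<in> B \<Longrightarrow> holder_norm l ?\<alpha> f \<le> ennreal (R B)"
    if B: "holder_bounded l ?\<alpha> B" for B :: "(real^'d \<Rightarrow> real) set"
  proof -
    have "\<exists>R. 0 \<le> R \<and> B \<subseteq> holder_space l ?\<alpha> \<and> (\<forall>f\<in>B. holder_norm l ?\<alpha> f \<le> ennreal R)"
      using holder_bounded_obtains[OF B] by metis
    from someI_ex[OF this] show "0 \<le> R B" "\<And>f. f \<in> B \<Longrightarrow> f \<in> holder_space l ?\<alpha>"
      "\<And>f. f \<in> B \<Longrightarrow> holder_norm l ?\<alpha> f \<le> ennreal (R B)"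
      unfolding R_def by auto
  qed
  define c where "c B = real CARD('d) * (\<integral>s. \<bar>K s\<bar> \<partial>lborel) ^ CARD('d) * R B * (\<integral>s. \<bar>s\<bar> powr \<beta> * \<bar>K s\<bar> \<partial>lborel)"
    for B :: "(real^'d \<Rightarrow> real) set"
  have c_nonneg: "0 \<le> c B" if "holder_bounded l ?\<alpha> B" for B :: "(real^'d \<Rightarrow> real) set"
    unfolding c_def using R(1)[OF that] by (intro mult_nonneg_nonneg zero_le_power integral_nonneg) auto
  have error: "\<bar>convolve f (mollifier K \<delta>) x - f x\<bar> \<le> c B * \<delta> powr \<beta>"
    if B: "holder_bounded l ?\<alpha> B" and "f \<in> B" "?KI" "0 < \<delta>" for B :: "(real^'d \<Rightarrow> real) set" and f \<delta> x
    unfolding c_def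
    using smoothing_error[OF R(2)[OF B that(2)] R(3)[OF B that(2)] R(1)[OF B] \<alpha>(1) K _ that(4)] that(3)
    unfolding \<alpha>(2) by blast
  show "\<forall>(B :: (real^'d \<Rightarrow> real) set) d.
        holder_bounded l ?\<alpha> B \<and> (\<forall>n\<ge>1. d n > 0) \<and> d \<longlonglongrightarrow> 0 \<longrightarrow>
        (\<forall>n\<ge>1. \<forall>f\<in>B. \<forall>x. integrable lborel (\<lambda>a. f a * mollifier K (d n) (x - a))) \<and>
        (\<exists>err :: nat \<Rightarrow> (real^'d \<Rightarrow> real) \<Rightarrow> real^'d \<Rightarrow> real.
           (\<forall>n\<ge>1. \<forall>f\<in>B. \<forall>x. convolve f (mollifier K (d n)) x = f x + err n f x) \<and>
           (\<forall>n\<ge>1. (SUP f\<in>B. sup_norm (err n f)) < \<infinity>) \<and>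
           (?KI \<longrightarrow> (\<lambda>n. enn2real (SUP f\<in>B. sup_norm (err n f))) \<in> O(\<lambda>n. d n powr \<beta>)))"
  proof (intro allI impI, elim conjE)
    fix B :: "(real^'d \<Rightarrow> real) set" and d :: "nat \<Rightarrow> real"
    assume B: "holder_bounded l ?\<alpha> B" and d: "\<forall>n\<ge>1. d n > 0"
    have f: "f \<in> borel_measurable borel" "\<bar>f x\<bar> \<le> R B" if "f \<in> B" for f x
      using holder_spaceD(3)[OF R(2)[OF B that]] abs_le_of_holder_norm_le[OF R(3)[OF B that] R(1)[OF B]] by auto
    define err :: "nat \<Rightarrow> (real^'d \<Rightarrow> real) \<Rightarrow> real^'d \<Rightarrow> real"
      where "err n f x = convolve f (mollifier K (d n)) x - f x" for n f x
    have sup_le: "(SUP f\<in>B. sup_norm (err n f)) \<le> ennreal b" if "\<And>f x. f \<in> B \<Longrightarrow> \<bar>err n f x\<bar> \<le> b" for n b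
      unfolding sup_norm_def using that by (intro SUP_least ennreal_leI) auto
    \<comment> \<open>As \<open>enn2real\<close> sends infinity to 0, this finiteness ensures that
      the order estimate speaks of the true supremum.\<close>
    have fin: "(SUP f\<in>B. sup_norm (err n f)) < \<infinity>" if "n \<ge> 1" for n
    proof -
      have "\<bar>err n f x\<bar> \<le> R B * (\<integral>a. \<bar>mollifier K (d n) (a :: real^'d)\<bar> \<partial>lborel) + R B" if "f \<in> B" for f x
        using abs_convolve_mollifier_le[OF f[OF that] KD(2), of "d n" x] f(2)[OF that, of x] d \<open>n \<ge> 1\<close>
        unfolding err_def by fastforce
      then have "(SUP f\<in>B. sup_norm (err n f)) \<le> ennreal (R B * (\<integral>a. \<bar>mollifier K (d n) (a :: real^'d)\<bar> \<partial>lborel) + R B)"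
        by (rule sup_le)
      also have "\<dots> < \<infinity>" by simp
      finally show ?thesis .
    qed
    have big: "(\<lambda>n. enn2real (SUP f\<in>B. sup_norm (err n f))) \<in> O(\<lambda>n. d n powr \<beta>)" if "?KI"
    proof (rule bigoI[where c = "c B"], rule eventually_sequentiallyI[of 1])
      fix n :: nat assume n: "1 \<le> n"
      have "(SUP f\<in>B. sup_norm (err n f)) \<le> ennreal (c B * d n powr \<beta>)"
      proof (rule sup_le)
        fix f x assume "f \<in> B"
        then show "\<bar>err n f x\<bar> \<le> c B * d n powr \<beta>"
          using error[OF B _ that] d n unfolding err_def by blast
      qed
      then have "enn2real (SUP f\<in>B. sup_norm (err n f)) \<le> c B * d n powr \<beta>"
        using c_nonneg[OF B] by (intro enn2real_leI) auto
      then show "norm (enn2real (SUP f\<in>B. sup_norm (err n f))) \<le> c B * norm (d n powr \<beta>)"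
        by simp
    qed
    show "(\<forall>n\<ge>1. \<forall>f\<in>B. \<forall>x. integrable lborel (\<lambda>a. f a * mollifier K (d n) (x - a))) \<and>
        (\<exists>err :: nat \<Rightarrow> (real^'d \<Rightarrow> real) \<Rightarrow> real^'d \<Rightarrow> real.
           (\<forall>n\<ge>1. \<forall>f\<in>B. \<forall>x. convolve f (mollifier K (d n)) x = f x + err n f x) \<and>
           (\<forall>n\<ge>1. (SUP f\<in>B. sup_norm (err n f)) < \<infinity>) \<and>
           (?KI \<longrightarrow> (\<lambda>n. enn2real (SUP f\<in>B. sup_norm (err n f))) \<in> O(\<lambda>n. d n powr \<beta>)))"
    proof (intro conjI exI[of _ err])
      show "\<forall>n\<ge>1. \<forall>f\<in>B. \<forall>x. integrable lborel (\<lambda>a. f a * mollifier K (d n) (x - a))"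
      proof (intro allI impI ballI)
        fix n :: nat and g x assume n: "1 \<le> n" and g: "g \<in> B"
        show "integrable lborel (\<lambda>a. g a * mollifier K (d n) (x - a))"
          by (rule convolve_integrable[OF f(1)[OF g] f(2)[OF g] KD(2)]) (use d n in blast)
      qed
      show "\<forall>n\<ge>1. \<forall>f\<in>B. \<forall>x. convolve f (mollifier K (d n)) x = f x + err n f x"
        by (simp add: err_def)
    qed (use fin big in blast)+
  qed
  define C_X where "C_X X = ennreal 3 * sup_norm K ^ CARD('d) * emeasure lborel X" for X :: "(real^'d) set"
  \<comment> \<open>The factor 3 again bounds \<open>2 + \<epsilon>\<close>. If the absolute moment
    of order \<beta> diverges, the constant is infinite.\<close>
  define C_B where "C_B B = (if ?KI then ennreal (3 * c B) else \<infinity>)" for B :: "(real^'d \<Rightarrow> real) set"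
  show "\<exists>(C_X :: (real^'d) set \<Rightarrow> ennreal) (C_B :: (real^'d \<Rightarrow> real) set \<Rightarrow> ennreal).
        (\<forall>X. emeasure lborel X < \<infinity> \<and> sup_norm K < \<infinity> \<longrightarrow> C_X X < \<infinity>) \<and>
        (\<forall>B. integrable lborel (\<lambda>x. \<bar>x\<bar> powr \<beta> * \<bar>K x\<bar>) \<longrightarrow> C_B B < \<infinity>) \<and>
        (\<forall>(M :: 'w measure) B X \<psi> \<xi> \<xi>' V d \<epsilon>.
           smoothing_setting M l (\<beta> - real l) B X \<psi> \<xi> \<xi>' V d \<epsilon> \<longrightarrow>
           (\<forall>n\<ge>1.
              ennreal (E_diff M V \<psi> \<xi> \<xi>' \<epsilon> n) \<le>
                C_X X * (SUP m\<in>{1..}. ess_sup_norm M (V m)) * sup_norm \<psi> *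
                  ennreal (1 / d n ^ CARD('d)) * (SUP a\<in>X. ennreal (P_exceed M K d \<psi> \<xi> \<xi>' \<epsilon> n a))
                + C_B B * sup_norm \<psi> * ennreal (d n powr \<beta>)
                + ennreal (2 + \<epsilon>) * ennreal (1 / d n ^ CARD('d)) * sup_norm K ^ CARD('d) * sup_norm \<psi> *
                  (\<integral>\<^sup>+\<omega>. (\<integral>\<^sup>+a\<in>-X. ennreal (V n \<omega> a) \<partial>lborel) \<partial>M)) \<and>
           (\<forall>n\<ge>1. (AE \<omega> in M. convolve (mollifier K (d n)) (V n \<omega>) = V n \<omega>) \<longrightarrow>
              ennreal (E_diff M V \<psi> \<xi> \<xi>' \<epsilon> n) \<le>
                C_X X * (SUP m\<in>{1..}. ess_sup_norm M (V m)) * sup_norm \<psi> *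
                  ennreal (1 / d n ^ CARD('d)) * (SUP a\<in>X. ennreal (P_exceed M K d \<psi> \<xi> \<xi>' \<epsilon> n a))
                + ennreal (2 + \<epsilon>) * ennreal (1 / d n ^ CARD('d)) * sup_norm K ^ CARD('d) * sup_norm \<psi> *
                  (\<integral>\<^sup>+\<omega>. (\<integral>\<^sup>+a\<in>-X. ennreal (V n \<omega> a) \<partial>lborel) \<partial>M)))"
  proof (rule exI[of _ C_X], rule exI[of _ C_B], intro conjI allI impI)
    fix X :: "(real^'d) set" assume "emeasure lborel X < \<infinity> \<and> sup_norm K < \<infinity>"
    then show "C_X X < \<infinity>"
      by (simp add: C_X_def ennreal_mult_less_top power_less_top_ennreal)
  next
    fix B :: "(real^'d \<Rightarrow> real) set" assume ?KI
    then show "C_B B < \<infinity>" by (simp add: C_B_def)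
  next
    fix M :: "'w measure" and B :: "(real^'d \<Rightarrow> real) set" and X \<psi> \<xi> \<xi>' V d \<epsilon> and n :: nat
    assume S: "smoothing_setting M l ?\<alpha> B X \<psi> \<xi> \<xi>' V d \<epsilon>" and n: "n \<ge> 1"
    interpret smoothing_setting M l ?\<alpha> B X \<psi> \<xi> \<xi>' V d \<epsilon> by (rule S)
    let ?T1 = "C_X X * (SUP m\<in>{1..}. ess_sup_norm M (V m)) * sup_norm \<psi> *
        ennreal (1 / d n ^ CARD('d)) * (SUP a\<in>X. ennreal (P_exceed M K d \<psi> \<xi> \<xi>' \<epsilon> n a))"
    let ?T3 = "ennreal (2 + \<epsilon>) * ennreal (1 / d n ^ CARD('d)) * sup_norm K ^ CARD('d) * sup_norm \<psi> *
        (\<integral>\<^sup>+\<omega>. (\<integral>\<^sup>+a\<in>-X. ennreal (V n \<omega> a) \<partial>lborel) \<partial>M)"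
    note bound = E_diff_bound[OF n KD(2), folded C_X_def]
    show "ennreal (E_diff M V \<psi> \<xi> \<xi>' \<epsilon> n) \<le> ?T1 + C_B B * sup_norm \<psi> * ennreal (d n powr \<beta>) + ?T3"
    proof (cases ?KI)
      case True
      have "ennreal (E_diff M V \<psi> \<xi> \<xi>' \<epsilon> n) \<le> ?T1 + ennreal (3 * (c B * d n powr \<beta>)) * sup_norm \<psi> + ?T3"
      proof (rule bound)
        show "0 \<le> c B * d n powr \<beta>" using c_nonneg[OF B_bounded] by simp
        show "AE \<omega> in M. \<forall>x. \<bar>convolve (V n \<omega>) (mollifier K (d n)) x - V n \<omega> x\<bar> \<le> c B * d n powr \<beta>"
          using V_in_B[OF n] by eventually_elim (use error[OF B_bounded _ True d_pos[OF n]] in blast)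
      qed
      also have "ennreal (3 * (c B * d n powr \<beta>)) * sup_norm \<psi> = C_B B * sup_norm \<psi> * ennreal (d n powr \<beta>)"
        using True c_nonneg[OF B_bounded] by (simp add: C_B_def ennreal_mult mult_ac)
      finally show ?thesis .
    next
      case False
      show ?thesis
      \<comment> \<open>An infinite \<open>C_B B\<close> makes the right side infinite except when
        \<open>sup_norm \<psi> = 0\<close>, where \<open>\<infinity> * 0 = 0\<close>; then \<psi>
        vanishes, and with it the left side.\<close>
      proof (cases "sup_norm \<psi> = 0")
        case True
        have "\<psi> x = 0" for x
        proof -
          have "ennreal \<bar>\<psi> x\<bar> \<le> sup_norm \<psi>"
            unfolding sup_norm_def by (rule SUP_upper) simp
          with True show ?thesis by simp
        qed
        then have "E_diff M V \<psi> \<xi> \<xi>' \<epsilon> n = 0" by (simp add: E_diff_def)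
        then show ?thesis by simp
      next
        case nz: False
        have "C_B B * sup_norm \<psi> * ennreal (d n powr \<beta>) = \<infinity>"
          using False nz d_pos[OF n] by (simp add: C_B_def ennreal_top_mult ennreal_mult_eq_top_iff)
        then show ?thesis by simp
      qed
    qed
    assume "AE \<omega> in M. convolve (mollifier K (d n)) (V n \<omega>) = V n \<omega>"
    then have "AE \<omega> in M. \<forall>x. \<bar>convolve (V n \<omega>) (mollifier K (d n)) x - V n \<omega> x\<bar> \<le> 0"
      using AE_space
    proof eventually_elim
      case (elim \<omega>)
      have "V n \<omega> \<in> borel_measurable borel"
        by (rule holder_spaceD(3)[OF V_in_holder_space[OF n elim(2)]])
      then show ?case
        using convolve_mollifier_commute[of "V n \<omega>" K "d n"] KD(1) elim(1) by simp
    qed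
    \<comment> \<open>Here \<open>e = 0\<close>, so the smoothing term of \<open>bound\<close>
      disappears.\<close>
    from bound[OF order_refl this] show "ennreal (E_diff M V \<psi> \<xi> \<xi>' \<epsilon> n) \<le> ?T1 + ?T3"
      by simp
  qed
qed

end
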